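(* Let $G=W(E_6)$ act on its $6$-dimensional real reflection representation $W$, let $V=W\oplus W$ with the diagonal action, and let $S^{11}=S(V)$. Let $Y\subset S^{11}$ be an unweighted $W(E_6)$-invariant spherical $4$-design containing a $W(E_6)$-orbit which is itself a spherical $2$-design. Then $$|Y|\ge378.$$ If equality holds, then $Y$ consists of exactly one $270$-point orbit that is a spherical $2$-design and four $27$-point rank-one correction orbits (orbits of nonzero defect whose Gram matrix has rank one), and the four normalized quadratic defects of the latter form a square in the unit circle $S^1=S(E_{\mathbb R})$.
   Context: $W(E_6)$ is the Weyl group of type $E_6$ (order $51840$) acting orthogonally on $W=\mathbb R^6$ by its standard reflection representation; $V=W\oplus W$ carries the orthogonal direct sum inner product. For $M=[x_1\ x_2]\in V$, the Gram matrix is $M^TM=((x_i,x_j))_{i,j}$, a real symmetric $2\times2$ matrix; it is constant on $G$-orbits. $E_{\mathbb R}$ is the $2$-dimensional space of traceless real symmetric $2\times 2$ matrices with inner product $\langle B,C\rangle_E=\operatorname{tr}(BC)$. For $M\in S(V)$ the quadratic defect is $Z(M)=M^TM-\frac12I_2\in E_{\mathbb R}$. A correction orbit is an orbit with nonzero defect; for a rank-one correction orbit the normalized defect is $\sqrt2\,Z(M)$, which lies in the unit circle $S(E_{\mathbb R})$. A finite set $X\subset S(V)$ is a (unweighted) spherical $t$-design if $\frac1{|X|}\sum_{x\in X}f(x)$ equals the average of $f$ over $S(V)$ with respect to normalized spherical measure for every real polynomial $f$ of degree at most $t$. *)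

theory Defs
  imports "HOL-Analysis.Analysis"
begin

section \<open>The Weyl group of type E6 and its diagonal action on V\<close>

type_synonym W = "real^6"

text \<open>The product type carries the inner product of the orthogonal direct sum; the pair
  \<open>(x, y)\<close> is the matrix \<open>M = [x y]\<close> with columns \<open>x\<close> and \<open>y\<close>.\<close>

type_synonym V = "W \<times> W"

text \<open>Edges of the Dynkin diagram in Bourbaki's labelling.\<close>

definition E6_edges :: "nat set set" where
  "E6_edges = {{1,3}, {3,4}, {4,5}, {5,6}, {2,4}}"

text \<open>The simple roots \<open>\<alpha> 1, \<dots>, \<alpha> 6\<close> are normalised to squared length 2. The Gram matrix
  determines them up to an isometry of \<open>W\<close>; values of \<open>\<alpha>\<close> outside \<open>{1..6}\<close> are irrelevant.\<close>

definition E6_simple_roots :: "(nat \<Rightarrow> W) \<Rightarrow> bool" where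
  "E6_simple_roots \<alpha> \<longleftrightarrow>
     (\<forall>i\<in>{1..6}. \<forall>j\<in>{1..6}.
        \<alpha> i \<bullet> \<alpha> j = (if i = j then 2 else if {i, j} \<in> E6_edges then -1 else 0))"

lemma E6_simple_roots_exist: "\<exists>\<alpha>. E6_simple_roots \<alpha>"
proof -
  let ?e = "\<lambda>i::6. axis i (1::real)"
  define \<alpha> where "\<alpha> =
    (\<lambda>_::nat. 0)(1 := (1/2) *\<^sub>R (?e 1 - ?e 2 - ?e 3 - ?e 4 - ?e 5) + (sqrt 3 / 2) *\<^sub>R ?e 6,
      2 := ?e 1 + ?e 2, 3 := ?e 2 - ?e 1, 4 := ?e 3 - ?e 2, 5 := ?e 4 - ?e 3,
      6 := ?e 5 - ?e 4)"
  have "{1..6} = {1, 2, 3, 4, 5, 6::nat}"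
    by auto
  then have "E6_simple_roots \<alpha>"
    by (simp add: E6_simple_roots_def E6_edges_def \<alpha>_def inner_axis_axis
        inner_add_left inner_add_right inner_diff_left inner_diff_right doubleton_eq_iff)
  then show ?thesis by blast
qed

definition reflection :: "'a::real_inner \<Rightarrow> 'a \<Rightarrow> 'a" where
  "reflection a x = x - (2 * (x \<bullet> a) / (a \<bullet> a)) *\<^sub>R a"

text \<open>Reflections are involutions, so the monoid generated by the simple reflections is
  already the group they generate.\<close>

inductive_set weyl_group :: "(nat \<Rightarrow> W) \<Rightarrow> (W \<Rightarrow> W) set" for \<alpha> where
  id: "id \<in> weyl_group \<alpha>"
| comp: "i \<in> {1..6} \<Longrightarrow> g \<in> weyl_group \<alpha> \<Longrightarrow> reflection (\<alpha> i) \<circ> g \<in> weyl_group \<alpha>"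

definition act :: "(W \<Rightarrow> W) \<Rightarrow> V \<Rightarrow> V" where
  "act g M = (g (fst M), g (snd M))"

definition weyl_orbit :: "(nat \<Rightarrow> W) \<Rightarrow> V \<Rightarrow> V set" where
  "weyl_orbit \<alpha> M = (\<lambda>g. act g M) ` weyl_group \<alpha>"

definition weyl_invariant :: "(nat \<Rightarrow> W) \<Rightarrow> V set \<Rightarrow> bool" where
  "weyl_invariant \<alpha> Y \<longleftrightarrow> (\<forall>g\<in>weyl_group \<alpha>. \<forall>M\<in>Y. act g M \<in> Y)"

section \<open>Spherical designs\<close>

text \<open>Multi-exponents are functions on the orthonormal basis \<open>Basis\<close>, extensional so that
  each monomial occurs once.\<close>

definition multi_exponents :: "nat \<Rightarrow> ('a::euclidean_space \<Rightarrow> nat) set" where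
  "multi_exponents t = {k \<in> Basis \<rightarrow>\<^sub>E {..t}. (\<Sum>b\<in>Basis. k b) \<le> t}"

definition polynomial_of_degree_le :: "nat \<Rightarrow> ('a::euclidean_space \<Rightarrow> real) \<Rightarrow> bool" where
  "polynomial_of_degree_le t f \<longleftrightarrow>
     (\<exists>c. \<forall>x. f x = (\<Sum>k\<in>multi_exponents t. c k * (\<Prod>b\<in>Basis. (x \<bullet> b) ^ k b)))"

text \<open>Normalised surface measure on the unit sphere, obtained as the image of the uniform
  distribution on the unit ball under the radial projection \<open>sgn x = x /\<^sub>R norm x\<close>
  (whose value 0 at the origin affects only a null set).\<close>

definition sphere_measure :: "'a::euclidean_space measure" where
  "sphere_measure = distr (uniform_measure lborel (ball 0 1)) borel sgn"

definition spherical_design :: "nat \<Rightarrow> 'a::euclidean_space set \<Rightarrow> bool" where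
  "spherical_design t X \<longleftrightarrow>
     finite X \<and> X \<subseteq> sphere 0 1 \<and>
     (\<forall>f. polynomial_of_degree_le t f \<longrightarrow>
        (\<Sum>x\<in>X. f x) / real (card X) = (\<integral>x. f x \<partial>sphere_measure))"

section \<open>Quadratic defects\<close>

definition gram :: "V \<Rightarrow> real^2^2" where
  "gram M = vector [vector [fst M \<bullet> fst M, fst M \<bullet> snd M],
                    vector [snd M \<bullet> fst M, snd M \<bullet> snd M]]"

definition E_space :: "(real^2^2) set" where
  "E_space = {B. transpose B = B \<and> trace B = 0}"

definition E_inner :: "real^2^2 \<Rightarrow> real^2^2 \<Rightarrow> real" where
  "E_inner B C = trace (B ** C)"

definition E_circle :: "(real^2^2) set" where
  "E_circle = {B \<in> E_space. E_inner B B = 1}"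

definition defect :: "V \<Rightarrow> real^2^2" where
  "defect M = gram M - (1/2) *\<^sub>R mat 1"

definition normalized_defect :: "V \<Rightarrow> real^2^2" where
  "normalized_defect M = sqrt 2 *\<^sub>R defect M"

definition rank_one_correction_orbit :: "(nat \<Rightarrow> W) \<Rightarrow> V set \<Rightarrow> bool" where
  "rank_one_correction_orbit \<alpha> C \<longleftrightarrow>
     (\<exists>M\<in>sphere 0 1. C = weyl_orbit \<alpha> M \<and> defect M \<noteq> 0 \<and> rank (gram M) = 1)"

text \<open>The vertex set \<open>p, p + u, p + u + v, p + v\<close> of a nondegenerate square.\<close>

definition is_square :: "(real^2^2) set \<Rightarrow> bool" where
  "is_square Q \<longleftrightarrow>
     (\<exists>p\<in>E_space. \<exists>u\<in>E_space. \<exists>v\<in>E_space.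
        u \<noteq> 0 \<and> E_inner u u = E_inner v v \<and> E_inner u v = 0 \<and>
        Q = {p, p + u, p + u + v, p + v})"

end

theory Submission
  imports Defs "HOL-Probability.Probability_Measure"
begin

text \<open>Encode the quadratic defect of \<open>M = [x y]\<close> in \<open>S(V)\<close> as the complex number
  \<open>z = |x|\<^sup>2 - |y|\<^sup>2 + 2 i (x, y)\<close>. It satisfies \<open>|z| \<le> 1\<close>, with equality exactly in rank one, and it
  is constant on orbits. A 4-design \<open>Y\<close> satisfies \<open>\<Sum> z = \<Sum> z\<^sup>2 = 0\<close> and \<open>\<Sum> |z|\<^sup>2 = 2 |Y| / 7\<close>, so at
  least \<open>2 |Y| / 7\<close> points have nonzero defect. The orbit that is a 2-design has defect zero; its points
  have linearly independent columns, so their stabilizers are parabolic of rank at most 4 and the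
  orbit has at least 270 points. Hence \<open>|Y| \<ge> 270 + 2 |Y| / 7\<close>, that is \<open>|Y| \<ge> 378\<close>.

  In the case of equality the remaining 108 points all have \<open>|z| = 1\<close>. As \<open>\<Sum> z = 0\<close>, an orbit of
  these has at most 54 points, and the only such orbits in \<open>W\<close> are those of the multiples of the
  minuscule weights, with 27 points. The defects of the four orbits are unit complex numbers with
  vanishing first and second power sums, hence a square.

  Orbit sizes are bounded from below by replacing a dominant vector by a sum of those fundamental
  weights at which it is positive: its stabilizer fixes each of them.\<close>

section \<open>Invariance of the sphere measure\<close>

text \<open>The number 270 is 51840 / 192: among parabolic subgroups of rank at most 4 the largest
  is W(D4), of order 192, obtained by deleting nodes 1 and 6. The number 54 is half of 108, because
  n equal unit numbers can only be cancelled by at least n others. The main obstacle is to bound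
  orbits of arbitrary real vectors under a group given by generators only. Comparing stabilizers
  reduces this to finitely many integral weights, whose orbits are listed by evaluation in integer
  coordinates; any list without repetitions bounds an orbit from below, so most enumerations may
  stop early. On the analytic side the moments of the defect follow from invariance under a few
  isometries of \<open>V\<close>.\<close>

lemma lborel_distr_orthogonal_cart:
  fixes f :: "real^'n::{finite,wellorder} \<Rightarrow> real^'n::_"
  assumes f: "orthogonal_transformation f"
  shows "distr lborel borel f = lborel"
proof (rule lborel_eqI[symmetric])
  have lin: "linear f" and bij: "bij f"
    using f by (auto simp: orthogonal_transformation_linear orthogonal_transformation_bij)
  have [measurable]: "f \<in> borel_measurable borel"
    using lin by (simp add: borel_measurable_continuous_onI linear_continuous_on linear_conv_bounded_linear)
  fix l u :: "real^'n::_" assume le: "\<And>b. b \<in> Basis \<Longrightarrow> l \<bullet> b \<le> u \<bullet> b"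
  let ?S = "f -` box l u"
  have im: "f ` ?S = box l u"
    using bij by (simp add: bij_is_surj surj_image_vimage_eq)
  have S: "?S = inv f ` box l u"
    using bij by (simp add: bij_vimage_eq_inv_image)
  have inv: "orthogonal_transformation (inv f)"
    by (simp add: f orthogonal_transformation_inv)
  have "?S \<in> lmeasurable"
    unfolding S by (intro measurable_orthogonal_image[OF inv]) simp
  have Sb: "?S \<in> sets borel"
    using measurable_sets_borel[of f borel "box l u"] by simp
  have fin: "emeasure lborel ?S < \<infinity>"
    using \<open>?S \<in> lmeasurable\<close> Sb by (simp add: fmeasurable_def)
  have "emeasure (distr lborel borel f) (box l u) = emeasure lborel ?S"
    by (subst emeasure_distr) auto
  also have "\<dots> = ennreal (measure lborel ?S)"
    using fin by (intro emeasure_eq_ennreal_measure) auto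
  also have "measure lborel ?S = measure lebesgue (inv f ` box l u)"
    using Sb by (simp add: S)
  also have "\<dots> = measure lebesgue (box l u)"
    by (rule measure_orthogonal_image[OF inv]) simp
  also have "ennreal (measure lebesgue (box l u)) = emeasure lborel (box l u)"
    using le by (simp add: measure_def)
  also have "\<dots> = (\<Prod>b\<in>Basis. (u - l) \<bullet> b)"
    using le by simp
  finally show "emeasure (distr lborel borel f) (box l u) = (\<Prod>b\<in>Basis. (u - l) \<bullet> b)" .
qed simp

text \<open>Orthogonal invariance of Lebesgue measure is first obtained on \<open>real^'n\<close>,
  while \<open>V\<close> is a product. A bijection of orthonormal bases gives an isometry between
  the two spaces; it matches boxes with boxes and so preserves the measure.\<close>

lemma basis_transport:
  assumes dim: "DIM('a::euclidean_space) = DIM('b::euclidean_space)"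
  obtains T :: "'a::euclidean_space \<Rightarrow> 'b::euclidean_space" and T' :: "'b \<Rightarrow> 'a" where "linear T" "linear T'"
    "\<And>x. T' (T x) = x" "\<And>y. T (T' y) = y" "\<And>x y. T x \<bullet> T y = x \<bullet> y"
    "\<And>x y. T' x \<bullet> T' y = x \<bullet> y" "distr lborel borel T = lborel"
proof -
  obtain p where p: "bij_betw p (Basis::'a set) (Basis::'b set)"
    using finite_same_card_bij[OF finite_Basis finite_Basis dim] by blast
  define T where "T x = (\<Sum>b\<in>Basis. (x \<bullet> b) *\<^sub>R p b)" for x
  define T' where "T' y = (\<Sum>b\<in>Basis. (y \<bullet> p b) *\<^sub>R b)" for y
  have lin: "linear T" "linear T'"
    by (auto simp: T_def T'_def linear_iff inner_add_left scaleR_add_left sum.distrib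
        scaleR_sum_right)
  have pB: "p b \<in> Basis" if "b \<in> Basis" for b
    using p that by (auto simp: bij_betw_def)
  have pin: "p b \<bullet> p c = (if b = c then 1 else 0)" if "b \<in> Basis" "c \<in> Basis" for b c
    using p that pB[OF that(1)] pB[OF that(2)]
    by (auto simp: inner_Basis bij_betw_def inj_on_eq_iff)
  have Tp: "T x \<bullet> p b = x \<bullet> b" if "b \<in> Basis" for x b
    using that by (simp add: T_def inner_sum_left pin if_distrib cong: if_cong)
  have T'b: "T' y \<bullet> b = y \<bullet> p b" if "b \<in> Basis" for y b
    using that by (simp add: T'_def)
  have 1: "T' (T x) = x" for x
    by (rule euclidean_eqI) (simp add: T'b Tp)
  have 2: "T (T' y) = y" for y
  proof (rule euclidean_eqI)
    fix b :: 'b assume "b \<in> Basis"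
    then obtain c where "c \<in> Basis" "b = p c"
      using p by (auto simp: bij_betw_def)
    then show "T (T' y) \<bullet> b = y \<bullet> b"
      by (simp add: T'b Tp)
  qed
  have 3: "T x \<bullet> T y = x \<bullet> y" for x y
  proof -
    have "T x \<bullet> T y = (\<Sum>b\<in>Basis. (x \<bullet> b) * (T y \<bullet> p b))"
      unfolding T_def[of x] by (simp add: inner_sum_left inner_commute[of "p _"])
    also have "\<dots> = x \<bullet> y"
      by (simp add: Tp euclidean_inner[of x y])
    finally show ?thesis .
  qed
  have 4: "T' x \<bullet> T' y = x \<bullet> y" for x y
    by (metis 2 3)
  have "distr lborel borel T = lborel"
  proof (rule lborel_eqI[symmetric])
    fix l u :: 'b assume le: "\<And>b. b \<in> Basis \<Longrightarrow> l \<bullet> b \<le> u \<bullet> b"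
    have [measurable]: "T \<in> borel_measurable borel"
      using lin by (simp add: borel_measurable_continuous_onI linear_continuous_on linear_conv_bounded_linear)
    have "T -` box l u = box (T' l) (T' u)"
    proof -
      have "T x \<in> box l u \<longleftrightarrow> x \<in> box (T' l) (T' u)" for x
      proof -
        have "T x \<in> box l u \<longleftrightarrow> (\<forall>b\<in>p ` Basis. l \<bullet> b < T x \<bullet> b \<and> T x \<bullet> b < u \<bullet> b)"
          using p by (simp add: mem_box bij_betw_def)
        then show ?thesis by (simp add: mem_box T'b Tp)
      qed
      then show ?thesis by auto
    qed
    then have "emeasure (distr lborel borel T) (box l u) = emeasure lborel (box (T' l) (T' u))"
      by (subst emeasure_distr) auto
    also have "\<dots> = (\<Prod>b\<in>Basis. (T' u - T' l) \<bullet> b)"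
      using le pB by (intro emeasure_lborel_box) (simp add: T'b)
    also have "(\<Prod>b\<in>Basis. (T' u - T' l) \<bullet> b) = (\<Prod>b\<in>Basis. (u - l) \<bullet> p b)"
      by (rule prod.cong) (auto simp: T'b inner_diff_left)
    also have "\<dots> = (\<Prod>b\<in>Basis. (u - l) \<bullet> b)"
      by (rule prod.reindex_bij_betw[OF p])
    finally show "emeasure (distr lborel borel T) (box l u) = (\<Prod>b\<in>Basis. (u - l) \<bullet> b)" .
  qed simp
  with lin 1 2 3 4 show thesis by (intro that)
qed

text \<open>Conjugation by the isometry of \<open>basis_transport\<close> turns \<open>f\<close>
  into an orthogonal map of \<open>real^'n\<close>.\<close>

lemma lborel_distr_orthogonal:
  fixes f :: "'a::euclidean_space \<Rightarrow> 'a"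
  assumes f: "orthogonal_transformation f"
    and dim: "DIM('a) = CARD('n::{finite,wellorder})"
  shows "distr lborel borel f = lborel"
proof -
  have dim': "DIM('a) = DIM(real^'n::_)" "DIM(real^'n::_) = DIM('a)"
    using dim by auto
  obtain T :: "'a \<Rightarrow> real^'n::_" and T' where T: "linear T" "linear T'"
    "\<And>x. T' (T x) = x" "\<And>y. T (T' y) = y" "\<And>x y. T x \<bullet> T y = x \<bullet> y"
    "\<And>x y. T' x \<bullet> T' y = x \<bullet> y" "distr lborel borel T = lborel"
    using basis_transport[OF dim'(1)] by blast
  have meas: "g \<in> borel_measurable borel" if "linear g" for g :: "'x::euclidean_space \<Rightarrow> 'y::euclidean_space"
    using that by (simp add: borel_measurable_continuous_onI linear_continuous_on linear_conv_bounded_linear)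
  have lf: "linear f" using f by (rule orthogonal_transformation_linear)
  note [measurable] = meas[OF T(1)] meas[OF T(2)] meas[OF lf]
  have 1: "distr lborel borel T' = lborel"
  proof -
    have "distr lborel borel T' = distr (distr lborel borel T) borel T'"
      by (simp add: T(7))
    also have "\<dots> = distr lborel borel (T' \<circ> T)"
      by (subst distr_distr) auto
    also have "T' \<circ> T = (\<lambda>x. x)" by (auto simp: T)
    finally show ?thesis by (simp add: distr_id2)
  qed
  let ?g = "T \<circ> f \<circ> T'"
  have g: "orthogonal_transformation ?g"
    using f by (auto simp: orthogonal_transformation_def T intro!: linear_compose)
  have "distr lborel borel f = distr (distr (distr lborel borel T) borel ?g) borel T'"
    by (subst distr_distr, simp, simp, subst distr_distr) (auto simp: o_def T)
  also have "\<dots> = lborel"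
    by (simp only: T(7) lborel_distr_orthogonal_cart[OF g] 1)
  finally show ?thesis .
qed

section \<open>Polynomials of bounded degree\<close>

lemma finite_multi_exponents: "finite (multi_exponents t :: ('a::euclidean_space \<Rightarrow> nat) set)"
  by (rule finite_subset[of _ "Basis \<rightarrow>\<^sub>E {..t}"]) (auto simp: multi_exponents_def intro: finite_PiE)

lemma polynomial_of_degree_le_monomial:
  fixes bs :: "'a::euclidean_space list"
  assumes "set bs \<subseteq> Basis" "length bs \<le> t"
  shows "polynomial_of_degree_le t (\<lambda>x. \<Prod>b\<leftarrow>bs. x \<bullet> b)"
proof -
  \<comment> \<open>The exponents count occurrences in the list; restricting them to
    \<open>Basis\<close> makes them extensional, as \<open>multi_exponents\<close> demands.\<close>
  define k where "k = restrict (count_list bs) Basis"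
  have len: "(\<Sum>b\<in>Basis. count_list bs b) = length bs"
  proof -
    have "(\<Sum>b\<in>Basis. count_list bs b) = (\<Sum>b\<in>set bs. count_list bs b)"
      using assms(1) by (intro sum.mono_neutral_right) (auto simp: count_list_0_iff)
    then show ?thesis by (simp add: sum_count_set)
  qed
  have "count_list bs b \<le> t" for b
    using count_le_length[of bs b] assms(2) by linarith
  then have k: "k \<in> multi_exponents t"
    using len assms(2) by (auto simp: multi_exponents_def k_def)
  have prod: "(\<Prod>b\<leftarrow>bs. x \<bullet> b) = (\<Prod>b\<in>Basis. (x \<bullet> b) ^ count_list bs b)" for x
    using assms(1)
  proof (induction bs)
    case (Cons c bs)
    then have "(\<Prod>b\<in>Basis. (x \<bullet> b) ^ count_list (c # bs) b)
      = (\<Prod>b\<in>Basis. (if c = b then x \<bullet> b else 1) * (x \<bullet> b) ^ count_list bs b)"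
      by (intro prod.cong) auto
    also have "\<dots> = (x \<bullet> c) * (\<Prod>b\<in>Basis. (x \<bullet> b) ^ count_list bs b)"
      using Cons.prems by (simp add: prod.distrib)
    finally show ?case using Cons by simp
  qed simp
  have "(\<Prod>b\<leftarrow>bs. x \<bullet> b) = (\<Sum>j\<in>multi_exponents t. of_bool (j = k) * (\<Prod>b\<in>Basis. (x \<bullet> b) ^ j b))" for x
  proof -
    have "(\<Sum>j\<in>multi_exponents t. of_bool (j = k) * (\<Prod>b\<in>Basis. (x \<bullet> b) ^ j b))
      = (\<Sum>j\<in>multi_exponents t. if j = k then \<Prod>b\<in>Basis. (x \<bullet> b) ^ j b else 0)"
      by (intro sum.cong) auto
    also have "\<dots> = (\<Prod>b\<in>Basis. (x \<bullet> b) ^ k b)"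
      using k by (simp add: finite_multi_exponents)
    also have "\<dots> = (\<Prod>b\<leftarrow>bs. x \<bullet> b)"
      by (simp add: prod k_def)
    finally show ?thesis ..
  qed
  then show ?thesis
    unfolding polynomial_of_degree_le_def by (intro exI[of _ "\<lambda>j. of_bool (j = k)"]) simp
qed

lemma polynomial_of_degree_le_cmult:
  "polynomial_of_degree_le t f \<Longrightarrow> polynomial_of_degree_le t (\<lambda>x. r * f x)"
  unfolding polynomial_of_degree_le_def
proof (elim exE)
  fix c assume "\<forall>x. f x = (\<Sum>k\<in>multi_exponents t. c k * (\<Prod>b\<in>Basis. (x \<bullet> b) ^ k b))"
  then show "\<exists>c. \<forall>x. r * f x = (\<Sum>k\<in>multi_exponents t. c k * (\<Prod>b\<in>Basis. (x \<bullet> b) ^ k b))"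
    by (intro exI[of _ "\<lambda>k. r * c k"]) (simp add: sum_distrib_left mult.assoc)
qed

lemma polynomial_of_degree_le_add:
  assumes "polynomial_of_degree_le t f" "polynomial_of_degree_le t g"
  shows "polynomial_of_degree_le t (\<lambda>x. f x + g x)"
proof -
  obtain c d where "\<And>x. f x = (\<Sum>k\<in>multi_exponents t. c k * (\<Prod>b\<in>Basis. (x \<bullet> b) ^ k b))"
    "\<And>x. g x = (\<Sum>k\<in>multi_exponents t. d k * (\<Prod>b\<in>Basis. (x \<bullet> b) ^ k b))"
    using assms unfolding polynomial_of_degree_le_def by blast
  then show ?thesis
    unfolding polynomial_of_degree_le_def
    by (intro exI[of _ "\<lambda>k. c k + d k"]) (simp add: distrib_right sum.distrib)
qed

lemma polynomial_of_degree_le_sum: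
  assumes "finite A" "\<And>i. i \<in> A \<Longrightarrow> polynomial_of_degree_le t (f i)"
  shows "polynomial_of_degree_le t (\<lambda>x. \<Sum>i\<in>A. f i x)"
  using assms
proof (induction A)
  case empty
  show ?case
    unfolding polynomial_of_degree_le_def by (intro exI[of _ "\<lambda>_. 0"]) simp
qed (simp add: polynomial_of_degree_le_add)

text \<open>With quadratic forms written as \<open>x \<bullet> T x\<close>, the Gram entries are
  recognised as polynomials without choosing coordinates on \<open>V\<close>.\<close>

lemma quadratic_form_expansion:
  fixes T :: "'a::euclidean_space \<Rightarrow> 'a"
  assumes "linear T"
  shows "x \<bullet> T x = (\<Sum>p\<in>Basis \<times> Basis. (T (snd p) \<bullet> fst p) * ((x \<bullet> fst p) * (x \<bullet> snd p)))"
proof -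
  have "T x = (\<Sum>c\<in>Basis. (x \<bullet> c) *\<^sub>R T c)"
    by (subst euclidean_representation[of x, symmetric])
      (simp add: linear_sum[OF assms] linear_scale[OF assms])
  then have "x \<bullet> T x = (\<Sum>b\<in>Basis. (x \<bullet> b) * (\<Sum>c\<in>Basis. (x \<bullet> c) * (T c \<bullet> b)))"
    by (subst euclidean_inner) (simp add: inner_sum_left)
  also have "\<dots> = (\<Sum>b\<in>Basis. \<Sum>c\<in>Basis. (T c \<bullet> b) * ((x \<bullet> b) * (x \<bullet> c)))"
    by (simp add: sum_distrib_left mult_ac)
  finally show ?thesis
    by (simp add: sum.cartesian_product case_prod_beta)
qed

lemma polynomial_of_degree_le_quadratic:
  fixes T :: "'a::euclidean_space \<Rightarrow> 'a"
  assumes "linear T" "2 \<le> t"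
  shows "polynomial_of_degree_le t (\<lambda>x. x \<bullet> T x)"
  unfolding quadratic_form_expansion[OF assms(1)]
proof (intro polynomial_of_degree_le_sum polynomial_of_degree_le_cmult)
  fix p :: "'a \<times> 'a" assume "p \<in> Basis \<times> Basis"
  then have "set [fst p, snd p] \<subseteq> Basis" by auto
  from polynomial_of_degree_le_monomial[OF this] assms(2)
  show "polynomial_of_degree_le t (\<lambda>x. (x \<bullet> fst p) * (x \<bullet> snd p))" by simp
qed simp

lemma polynomial_of_degree_le_quartic:
  fixes S T :: "'a::euclidean_space \<Rightarrow> 'a"
  assumes "linear S" "linear T" "4 \<le> t"
  shows "polynomial_of_degree_le t (\<lambda>x. (x \<bullet> S x) * (x \<bullet> T x))"
  unfolding quadratic_form_expansion[OF assms(1)] quadratic_form_expansion[OF assms(2)]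
    sum_product
proof (intro polynomial_of_degree_le_sum)
  fix p q :: "'a \<times> 'a" assume "p \<in> Basis \<times> Basis" "q \<in> Basis \<times> Basis"
  then have "set [fst p, snd p, fst q, snd q] \<subseteq> Basis" by auto
  from polynomial_of_degree_le_monomial[OF this] assms(3)
  have "polynomial_of_degree_le t (\<lambda>x. (x \<bullet> fst p) * ((x \<bullet> snd p) * ((x \<bullet> fst q) * (x \<bullet> snd q))))"
    by simp
  from polynomial_of_degree_le_cmult[OF this, of "(S (snd p) \<bullet> fst p) * (T (snd q) \<bullet> fst q)"]
  show "polynomial_of_degree_le t (\<lambda>x.
     (S (snd p) \<bullet> fst p) * ((x \<bullet> fst p) * (x \<bullet> snd p)) *
     ((T (snd q) \<bullet> fst q) * ((x \<bullet> fst q) * (x \<bullet> snd q))))"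
    by (simp add: mult_ac)
qed simp_all

section \<open>Integration against the sphere measure\<close>

lemma borel_measurable_sgn_euclidean [measurable]:
  "(sgn :: 'a::euclidean_space \<Rightarrow> 'a) \<in> borel_measurable borel"
  unfolding sgn_div_norm[abs_def] by measurable

lemma prob_space_ball: "prob_space (uniform_measure lborel (ball (0::'a::euclidean_space) 1))"
proof (rule prob_space_uniform_measure)
  show "emeasure lborel (ball (0::'a) 1) \<noteq> 0"
    by (simp add: emeasure_ball ennreal_eq_0_iff not_le)
  show "emeasure lborel (ball (0::'a) 1) \<noteq> \<infinity>"
    using emeasure_lborel_ball_finite[of "0::'a" 1] by simp
qed

text \<open>An orthogonal map preserves the ball and its volume and commutes with
  \<open>sgn\<close>, so invariance passes from the ball to its radial projection.\<close>

lemma sphere_measure_orthogonal: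
  fixes f :: "'a::euclidean_space \<Rightarrow> 'a"
  assumes f: "orthogonal_transformation f" and lborel: "distr lborel borel f = lborel"
  shows "distr sphere_measure borel f = sphere_measure"
proof -
  let ?U = "uniform_measure lborel (ball (0::'a) 1)"
  have lin: "linear f" using f by (rule orthogonal_transformation_linear)
  have [measurable]: "f \<in> borel_measurable borel"
    using lin by (simp add: borel_measurable_continuous_onI linear_continuous_on linear_conv_bounded_linear)
  have norm: "norm (f x) = norm x" for x
    using f by (simp add: orthogonal_transformation_norm)
  have sgn: "f (sgn x) = sgn (f x)" for x
    by (simp add: sgn_div_norm linear_scale[OF lin] norm)
  have U: "distr ?U borel f = ?U"
  proof (rule measure_eqI)
    fix A assume "A \<in> sets (distr ?U borel f)"
    then have [measurable]: "A \<in> sets borel" by simp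
    have "emeasure (distr ?U borel f) A = emeasure ?U (f -` A)"
      by (subst emeasure_distr) auto
    also have "\<dots> = emeasure lborel (ball 0 1 \<inter> f -` A) / emeasure lborel (ball (0::'a) 1)"
      using measurable_sets_borel[of f borel A] by (intro emeasure_uniform_measure) auto
    also have "ball 0 1 \<inter> f -` A = f -` (ball 0 1 \<inter> A)"
      by (auto simp: norm)
    also have "emeasure lborel (f -` (ball 0 1 \<inter> A)) = emeasure (distr lborel borel f) (ball 0 1 \<inter> A)"
      by (subst emeasure_distr) auto
    also have "\<dots> / emeasure lborel (ball (0::'a) 1) = emeasure ?U A"
      unfolding lborel by (subst emeasure_uniform_measure) auto
    finally show "emeasure (distr ?U borel f) A = emeasure ?U A" .
  qed simp
  have "distr sphere_measure borel f = distr ?U borel (f \<circ> sgn)"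
    unfolding sphere_measure_def by (subst distr_distr) auto
  also have "f \<circ> sgn = sgn \<circ> f" by (auto simp: sgn)
  also have "distr ?U borel (sgn \<circ> f) = distr (distr ?U borel f) borel sgn"
    by (subst distr_distr) auto
  finally show ?thesis by (simp add: U sphere_measure_def)
qed

lemma integral_sphere_measure_orthogonal:
  fixes f :: "'a::euclidean_space \<Rightarrow> 'a" and h :: "'a \<Rightarrow> real"
  assumes "orthogonal_transformation f" "distr lborel borel f = lborel" "continuous_on UNIV h"
  shows "(\<integral>x. h (f x) \<partial>sphere_measure) = (\<integral>x. h x \<partial>sphere_measure)"
proof -
  have [measurable]: "f \<in> borel_measurable borel" "h \<in> borel_measurable borel"
    using orthogonal_transformation_linear[OF assms(1)] assms(3)
    by (simp_all add: borel_measurable_continuous_onI linear_continuous_on linear_conv_bounded_linear)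
  have [measurable_cong]: "sets (sphere_measure :: 'a measure) = sets borel"
    by (simp add: sphere_measure_def)
  have "(\<integral>x. h x \<partial>sphere_measure) = (\<integral>x. h x \<partial>distr sphere_measure borel f)"
    by (simp add: sphere_measure_orthogonal assms)
  also have "\<dots> = (\<integral>x. h (f x) \<partial>sphere_measure)"
    by (rule integral_distr) measurable
  finally show ?thesis ..
qed

lemma integrable_sphere_measure:
  fixes h :: "'a::euclidean_space \<Rightarrow> real"
  assumes "continuous_on UNIV h"
  shows "integrable sphere_measure h"
proof -
  interpret prob_space "uniform_measure lborel (ball (0::'a) 1)" by (rule prob_space_ball)
  have [measurable]: "h \<in> borel_measurable borel"
    using assms by (rule borel_measurable_continuous_onI)
  have "bounded (h ` cball 0 1)"
    using assms by (intro compact_imp_bounded compact_continuous_image)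
      (auto intro: continuous_on_subset)
  then obtain B where B: "\<And>x. norm x \<le> 1 \<Longrightarrow> norm (h x) \<le> B"
    unfolding bounded_iff by (metis image_eqI mem_cball_0)
  have "integrable (uniform_measure lborel (ball (0::'a) 1)) (\<lambda>x. h (sgn x))"
  proof (rule integrable_const_bound[of _ B])
    have "norm (h (sgn x)) \<le> B" for x
      by (rule B) (simp add: norm_sgn)
    then show "AE x in uniform_measure lborel (ball (0::'a) 1). norm (h (sgn x)) \<le> B"
      by simp
  qed simp
  then show ?thesis
    unfolding sphere_measure_def by (subst integrable_distr_eq) auto
qed

text \<open>This quartic fixes the scale of the fourth moments, which symmetry determines only up to
  a common factor.\<close>

lemma integral_sphere_measure_norm:
  "(\<integral>x. (x \<bullet> x)\<^sup>2 \<partial>(sphere_measure :: 'a::euclidean_space measure)) = 1"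
proof -
  let ?U = "uniform_measure lborel (ball (0::'a) 1)"
  interpret prob_space ?U by (rule prob_space_ball)
  have "(\<integral>x. (x \<bullet> x)\<^sup>2 \<partial>(sphere_measure :: 'a measure)) = (\<integral>x. (sgn x \<bullet> sgn x)\<^sup>2 \<partial>?U)"
    unfolding sphere_measure_def by (rule integral_distr) auto
  also have "\<dots> = (\<integral>x. 1 \<partial>?U)"
  \<comment> \<open>\<open>sgn 0\<close> is 0, so the integrand equals 1 only away from the
    origin.\<close>
  proof (rule integral_cong_AE)
    have "AE x in lborel. x \<noteq> (0::'a)"
      by (rule AE_lborel_singleton)
    then have "AE x in ?U. x \<noteq> 0"
      by (intro AE_uniform_measureI) auto
    then show "AE x in ?U. (sgn x \<bullet> sgn x)\<^sup>2 = 1"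
      by eventually_elim (simp add: dot_square_norm norm_sgn)
  qed auto
  finally show ?thesis using prob_space by simp
qed

section \<open>Weights in coordinates\<close>

type_synonym coords = "int \<times> int \<times> int \<times> int \<times> int \<times> int"

text \<open>Coordinates are the pairings with the simple roots, that is, the coefficients of the
  fundamental weights. Subtracting the i-th entry times \<open>\<alpha> i\<close> negates that entry
  and adds it to its neighbours in the diagram. Every index other than 1 to 5 acts as node
  6.\<close>

definition weight_refl :: "nat \<Rightarrow> coords \<Rightarrow> coords" where
  "weight_refl i = (\<lambda>(a, b, c, d, e, f).
     if i = 1 then (- a, b, c + a, d, e, f)
     else if i = 2 then (a, - b, c, d + b, e, f)
     else if i = 3 then (a + c, b, - c, d + c, e, f)
     else if i = 4 then (a, b + d, c + d, - d, e + d, f)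
     else if i = 5 then (a, b, c, d + e, - e, f + e)
     else (a, b, c, d, e + f, - f))"

text \<open>In simple root coordinates a reflection alters only its own entry, to the sum of the
  neighbouring entries minus itself.\<close>

definition root_refl :: "nat \<Rightarrow> coords \<Rightarrow> coords" where
  "root_refl i = (\<lambda>(a, b, c, d, e, f).
     if i = 1 then (c - a, b, c, d, e, f)
     else if i = 2 then (a, d - b, c, d, e, f)
     else if i = 3 then (a, b, a + d - c, d, e, f)
     else if i = 4 then (a, b, c, b + c + e - d, e, f)
     else if i = 5 then (a, b, c, d, d + f - e, f)
     else (a, b, c, d, e, e - f))"

definition unit_coords :: "nat \<Rightarrow> coords" where
  "unit_coords i = (of_bool (i = 1), of_bool (i = 2), of_bool (i = 3), of_bool (i = 4),
     of_bool (i = 5), of_bool (i = 6))"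

text \<open>The 36 positive roots of E6, ordered by coordinate sum.\<close>

definition positive_root_coords :: "coords list" where
  "positive_root_coords = [(0,0,0,0,0,1), (0,0,0,0,1,0), (0,0,0,1,0,0), (0,0,1,0,0,0), (0,1,0,0,0,0),
     (1,0,0,0,0,0), (0,0,0,0,1,1), (0,0,0,1,1,0), (0,0,1,1,0,0), (0,1,0,1,0,0),
     (1,0,1,0,0,0), (0,0,0,1,1,1), (0,0,1,1,1,0), (0,1,0,1,1,0), (0,1,1,1,0,0),
     (1,0,1,1,0,0), (0,0,1,1,1,1), (0,1,0,1,1,1), (0,1,1,1,1,0), (1,0,1,1,1,0),
     (1,1,1,1,0,0), (0,1,1,1,1,1), (0,1,1,2,1,0), (1,0,1,1,1,1), (1,1,1,1,1,0),
     (0,1,1,2,1,1), (1,1,1,1,1,1), (1,1,1,2,1,0), (0,1,1,2,2,1), (1,1,1,2,1,1),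
     (1,1,2,2,1,0), (1,1,1,2,2,1), (1,1,2,2,1,1), (1,1,2,2,2,1), (1,1,2,3,2,1),
     (1,2,2,3,2,1)]"

lemma positive_root_coords_refl:
  "\<forall>v\<in>set positive_root_coords. \<forall>i\<in>set [1, 2, 3, 4, 5, 6].
     v = unit_coords i \<or> root_refl i v \<in> set positive_root_coords"
  by code_simp

lemma unit_coords_in_positive_root_coords:
  "\<forall>i\<in>set [1, 2, 3, 4, 5, 6]. unit_coords i \<in> set positive_root_coords"
  by code_simp

lemma positive_root_coords_nonneg:
  "\<forall>(a, b, c, d, e, f)\<in>set positive_root_coords.
     0 \<le> a \<and> 0 \<le> b \<and> 0 \<le> c \<and> 0 \<le> d \<and> 0 \<le> e \<and> 0 \<le> f"
  by code_simp

section \<open>Enumeration of weight orbits\<close>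

definition first_negative :: "coords \<Rightarrow> nat" where
  "first_negative = (\<lambda>(a, b, c, d, e, f).
     if a < 0 then 1 else if b < 0 then 2 else if c < 0 then 3
     else if d < 0 then 4 else if e < 0 then 5 else if f < 0 then 6 else 0)"

text \<open>Reflecting an element of an orbit in its first negative coordinate gives its parent, and
  this makes the orbit a tree rooted at the dominant element.\<close>

definition parent :: "coords \<Rightarrow> coords" where
  "parent v = (if first_negative v = 0 then v else weight_refl (first_negative v) v)"

text \<open>A reflected vector is kept only if \<open>v\<close> is its parent, so a vector reachable
  by several words is listed once. \<open>n\<close> bounds the depth, and cutting the tree merely
  shortens the list.\<close>

primrec orbit_tree :: "nat \<Rightarrow> coords \<Rightarrow> coords list" where
  "orbit_tree 0 v = [v]"
| "orbit_tree (Suc n) v = v # concat (map (\<lambda>i.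
     if first_negative (weight_refl i v) = i then orbit_tree n (weight_refl i v) else [])
     [1, 2, 3, 4, 5, 6])"

lemma first_negative_eq_iff:
  "first_negative (a, b, c, d, e, f) = 1 \<longleftrightarrow> a < 0"
  "first_negative (a, b, c, d, e, f) = 2 \<longleftrightarrow> 0 \<le> a \<and> b < 0"
  "first_negative (a, b, c, d, e, f) = 3 \<longleftrightarrow> 0 \<le> a \<and> 0 \<le> b \<and> c < 0"
  "first_negative (a, b, c, d, e, f) = 4 \<longleftrightarrow> 0 \<le> a \<and> 0 \<le> b \<and> 0 \<le> c \<and> d < 0"
  "first_negative (a, b, c, d, e, f) = 5 \<longleftrightarrow>
     0 \<le> a \<and> 0 \<le> b \<and> 0 \<le> c \<and> 0 \<le> d \<and> e < 0"
  "first_negative (a, b, c, d, e, f) = 6 \<longleftrightarrow>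
     0 \<le> a \<and> 0 \<le> b \<and> 0 \<le> c \<and> 0 \<le> d \<and> 0 \<le> e \<and> f < 0"
  by (simp_all add: first_negative_def)

lemma weight_refl_simps:
  "weight_refl 1 (a, b, c, d, e, f) = (- a, b, c + a, d, e, f)"
  "weight_refl 2 (a, b, c, d, e, f) = (a, - b, c, d + b, e, f)"
  "weight_refl 3 (a, b, c, d, e, f) = (a + c, b, - c, d + c, e, f)"
  "weight_refl 4 (a, b, c, d, e, f) = (a, b + d, c + d, - d, e + d, f)"
  "weight_refl 5 (a, b, c, d, e, f) = (a, b, c, d + e, - e, f + e)"
  "weight_refl 6 (a, b, c, d, e, f) = (a, b, c, d, e + f, - f)"
  by (simp_all add: weight_refl_def)

text \<open>For evaluation: entry i is negative after the reflection exactly when it is positive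
  before, so each child is tested before it is formed.\<close>

lemma orbit_tree_code [code]:
  "orbit_tree 0 v = [v]"
  "orbit_tree (Suc n) (a, b, c, d, e, f) = (a, b, c, d, e, f) #
     (if 0 < a then orbit_tree n (- a, b, c + a, d, e, f) else []) @
     (if 0 \<le> a \<and> 0 < b then orbit_tree n (a, - b, c, d + b, e, f) else []) @
     (if 0 \<le> a + c \<and> 0 \<le> b \<and> 0 < c then orbit_tree n (a + c, b, - c, d + c, e, f) else []) @
     (if 0 < d \<and> 0 \<le> a \<and> 0 \<le> b + d \<and> 0 \<le> c + d
      then orbit_tree n (a, b + d, c + d, - d, e + d, f) else []) @
     (if 0 < e \<and> 0 \<le> a \<and> 0 \<le> b \<and> 0 \<le> c \<and> 0 \<le> d + e
      then orbit_tree n (a, b, c, d + e, - e, f + e) else []) @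
     (if 0 < f \<and> 0 \<le> a \<and> 0 \<le> b \<and> 0 \<le> c \<and> 0 \<le> d \<and> 0 \<le> e + f
      then orbit_tree n (a, b, c, d, e + f, - f) else [])"
  by (simp_all only: orbit_tree.simps list.map concat.simps weight_refl_simps
      first_negative_eq_iff neg_less_0_iff_less append_Nil2 conj_ac)

text \<open>The pairing with the sum of the positive coroots.\<close>

definition height :: "coords \<Rightarrow> int" where
  "height = (\<lambda>(a, b, c, d, e, f). 16 * a + 22 * b + 30 * c + 42 * d + 30 * e + 16 * f)"

lemma weight_refl_involutive [simp]: "weight_refl i (weight_refl i v) = v"
  by (cases v) (simp add: weight_refl_def)

text \<open>Reflecting in a negative entry a adds -a times a simple root, and a simple root pairs to
  2 with the sum of the positive coroots; the height grows by -2a.\<close>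

lemma height_parent: "first_negative v \<noteq> 0 \<Longrightarrow> height v < height (parent v)"
  by (cases v) (auto simp: parent_def first_negative_def weight_refl_def height_def split: if_splits)

lemma height_parent_le: "height v \<le> height (parent v)"
  using height_parent[of v] by (cases "first_negative v = 0") (auto simp: parent_def)

lemma height_parent_funpow_le: "height v \<le> height ((parent ^^ k) v)"
  by (induction k) (auto intro: order_trans height_parent_le)

lemma parent_child:
  assumes "first_negative (weight_refl i v) = i" "i \<noteq> 0"
  shows "parent (weight_refl i v) = v" "height (weight_refl i v) < height v"
proof -
  show "parent (weight_refl i v) = v"
    using assms by (simp add: parent_def)
  with height_parent[of "weight_refl i v"] assms show "height (weight_refl i v) < height v"
    by simp
qed

lemma orbit_tree_ancestor: "w \<in> set (orbit_tree n v) \<Longrightarrow> \<exists>k. (parent ^^ k) w = v"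
proof (induction n arbitrary: v)
  case 0
  then show ?case by (auto intro: exI[of _ 0])
next
  case (Suc n)
  then consider "w = v" | i where "i \<in> set [1, 2, 3, 4, 5, 6]"
      "first_negative (weight_refl i v) = i" "w \<in> set (orbit_tree n (weight_refl i v))"
    by (auto split: if_splits)
  then show ?case
  proof cases
    case 1
    then show ?thesis by (auto intro: exI[of _ 0])
  next
    case 2
    then obtain k where "(parent ^^ k) w = weight_refl i v"
      using Suc.IH by blast
    with 2 have "(parent ^^ Suc k) w = v"
      using parent_child(1)[of i v] by auto
    then show ?thesis ..
  qed
qed

text \<open>The ancestors of \<open>w\<close> form a chain, so one of \<open>u\<close> and
  \<open>u'\<close> is an iterated parent of the other. If they differ, the chain passes through
  \<open>v\<close>, which lies strictly higher than both and from which parents never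
  descend.\<close>

lemma siblings_disjoint:
  assumes "parent u = v" "height u < height v" "parent u' = v" "height u' < height v"
    and "(parent ^^ k) w = u" "(parent ^^ m) w = u'"
  shows "u = u'"
proof -
  have *: "x = y" if "k \<le> m" "(parent ^^ k) w = x" "(parent ^^ m) w = y"
    "parent x = v" "height y < height v" for x y k m
  proof (rule ccontr)
    assume "x \<noteq> y"
    have y: "y = (parent ^^ (m - k)) x"
      using that(1-3) funpow_add[of "m - k" k parent] by simp
    obtain j where j: "m - k = Suc j"
      using y \<open>x \<noteq> y\<close> by (cases "m - k") simp_all
    have "y = (parent ^^ j) (parent x)"
      using y unfolding j funpow_Suc_right by simp
    then have "y = (parent ^^ j) v"
      unfolding that(4) .
    then show False
      using height_parent_funpow_le[of v j] that(5) by simp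
  qed
  show ?thesis
  proof (cases "k \<le> m")
    case True
    then show ?thesis by (rule *) (fact assms)+
  next
    case False
    then have "m \<le> k" by simp
    then have "u' = u" by (rule *) (fact assms)+
    then show ?thesis ..
  qed
qed

lemma distinct_concat_map:
  assumes "distinct xs" "\<And>i. i \<in> set xs \<Longrightarrow> distinct (f i)"
    and "\<And>i j w. i \<in> set xs \<Longrightarrow> j \<in> set xs \<Longrightarrow> w \<in> set (f i) \<Longrightarrow> w \<in> set (f j) \<Longrightarrow> i = j"
  shows "distinct (concat (map f xs))"
  using assms
proof (induction xs)
  case (Cons x xs)
  have "distinct (concat (map f xs))"
    using Cons.prems by (intro Cons.IH) auto
  moreover have "set (f x) \<inter> set (f i) = {}" if "i \<in> set xs" for i
    using Cons.prems(1) Cons.prems(3)[of x i] that by auto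
  ultimately show ?case
    using Cons.prems(2)[of x] by auto
qed simp

text \<open>Thanks to this, counting orbit elements is a matter of list length, and no vectors have
  to be compared during evaluation.\<close>

lemma distinct_orbit_tree: "distinct (orbit_tree n v)"
proof (induction n arbitrary: v)
  case (Suc n)
  let ?I = "[1, 2, 3, 4, 5, 6] :: nat list"
  let ?f = "\<lambda>i. if first_negative (weight_refl i v) = i then orbit_tree n (weight_refl i v) else []"
  have child: "first_negative (weight_refl i v) = i \<and> parent (weight_refl i v) = v
      \<and> height (weight_refl i v) < height v \<and> (\<exists>k. (parent ^^ k) w = weight_refl i v)"
    if "i \<in> set ?I" "w \<in> set (?f i)" for i w
    using that parent_child[of i v] orbit_tree_ancestor[of w n "weight_refl i v"]
    by (auto split: if_splits)
  have "distinct (concat (map ?f ?I))"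
  proof (rule distinct_concat_map)
    fix i j w assume "i \<in> set ?I" "j \<in> set ?I" "w \<in> set (?f i)" "w \<in> set (?f j)"
    then show "i = j"
      using child[of i w] child[of j w] siblings_disjoint by metis
  qed (use Suc in auto)
  moreover have "v \<notin> set (concat (map ?f ?I))"
  proof
    assume "v \<in> set (concat (map ?f ?I))"
    then obtain i where "i \<in> set ?I" "v \<in> set (?f i)" by auto
    from child[OF this] show False
      using height_parent_funpow_le[of v] by (metis not_le)
  qed
  ultimately show ?case
    by (simp only: orbit_tree.simps distinct.simps not_False_eq_True simp_thms)
qed simp

text \<open>Depths at which the orbit trees of \<open>\<omega> i + \<omega> j\<close> have reached 270 elements; the orbit for the
  pair \<open>(1, 6)\<close> is complete at that point.\<close>

definition pair_depths :: "((nat \<times> nat) \<times> nat) list" where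
  "pair_depths = [((1,2),15), ((1,3),15), ((1,4),9), ((1,5),11), ((1,6),24), ((2,3),11),
     ((2,4),10), ((2,5),11), ((2,6),15), ((3,4),9), ((3,5),9), ((3,6),11), ((4,5),9),
     ((4,6),9), ((5,6),15)]"

lemma pair_depths_complete:
  "\<forall>i\<in>set [1, 2, 3, 4, 5, 6]. \<forall>j\<in>set [1, 2, 3, 4, 5, 6].
     i < j \<longrightarrow> (i, j) \<in> set (map fst pair_depths)"
  by code_simp

definition add_coords :: "coords \<Rightarrow> coords \<Rightarrow> coords" where
  "add_coords = (\<lambda>(a, b, c, d, e, f) (a', b', c', d', e', f').
     (a + a', b + b', c + c', d + d', e + e', f + f'))"

text \<open>The depth 24 for the pair (1, 6) is 36 - 12, the number of positive roots of E6 outside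
  the stabilizer type D4.\<close>

lemma orbit_tree_pair_count:
  "\<forall>((i, j), n)\<in>set pair_depths. 270 \<le> length
     (orbit_tree n (add_coords (unit_coords i) (unit_coords j)))"
  by code_simp

text \<open>The full orbits have 72, 216, 720 and 216 elements; the aim is only to exceed 54, and
  depth 14 achieves it.\<close>

lemma orbit_tree_single_count:
  "\<forall>i\<in>set [2, 3, 4, 5]. 55 \<le> length (orbit_tree 14 (unit_coords i))"
  by code_simp

definition refl_closed :: "coords list \<Rightarrow> bool" where
  "refl_closed vs \<longleftrightarrow> (\<forall>v\<in>set vs. \<forall>i\<in>set [1, 2, 3, 4, 5, 6]. weight_refl i v \<in> set vs)"

lemma length_orbit_tree_minuscule:
  "\<forall>i\<in>set [1, 6]. length (orbit_tree 16 (unit_coords i)) = 27"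
  by code_simp

text \<open>A list closed under the simple reflections contains the whole orbit of each member, so
  its length 27 is an upper bound as well. Depth 16 is 36 - 20, with 20 positive roots in the
  stabilizer type D5.\<close>

lemma refl_closed_orbit_tree_minuscule:
  "\<forall>i\<in>set [1, 6]. refl_closed (orbit_tree 16 (unit_coords i))"
  by code_simp

section \<open>The root system of type E6\<close>

declare One_nat_def [simp del]

lemma reflection_linear: "linear (reflection a)"
proof
  show "reflection a (x + y) = reflection a x + reflection a y" for x y
    by (simp add: reflection_def inner_add_left distrib_left add_divide_distrib scaleR_add_left)
  show "reflection a (r *\<^sub>R x) = r *\<^sub>R reflection a x" for r x
    by (simp add: reflection_def scaleR_diff_right mult.left_commute)
qed

lemma reflection_inner [simp]: "reflection a x \<bullet> reflection a y = x \<bullet> y"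
proof (cases "a = 0")
  case False
  then have "a \<bullet> a \<noteq> 0" by simp
  then show ?thesis
    by (simp add: reflection_def inner_diff_left inner_diff_right inner_commute field_simps)
qed (simp add: reflection_def)

lemma reflection_involutive [simp]: "reflection a (reflection a x) = x"
  by (cases "a = 0") (simp_all add: reflection_def inner_diff_left algebra_simps)

lemma reflection_equivariant:
  assumes "linear g" "\<And>x y. g x \<bullet> g y = x \<bullet> y"
  shows "g (reflection a x) = reflection (g a) (g x)"
  using assms by (simp add: reflection_def linear_diff linear_scale)

definition lincomb :: "(nat \<Rightarrow> W) \<Rightarrow> coords \<Rightarrow> W" where
  "lincomb b = (\<lambda>(k1, k2, k3, k4, k5, k6).
     real_of_int k1 *\<^sub>R b 1 + real_of_int k2 *\<^sub>R b 2 + real_of_int k3 *\<^sub>R b 3 +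
     real_of_int k4 *\<^sub>R b 4 + real_of_int k5 *\<^sub>R b 5 + real_of_int k6 *\<^sub>R b 6)"

locale e6_system =
  fixes \<alpha> :: "nat \<Rightarrow> W"
  assumes simple_roots: "E6_simple_roots \<alpha>"
begin

lemma nodes: "{1..6::nat} = {1, 2, 3, 4, 5, 6}" "set [1, 2, 3, 4, 5, 6::nat] = {1..6}"
  by auto

lemma root_inner:
  "i \<in> {1..6} \<Longrightarrow> j \<in> {1..6} \<Longrightarrow>
     \<alpha> i \<bullet> \<alpha> j = (if i = j then 2 else if {i, j} \<in> E6_edges then -1 else 0)"
  using simple_roots unfolding E6_simple_roots_def by blast

lemma root_inner_self: "i \<in> {1..6} \<Longrightarrow> \<alpha> i \<bullet> \<alpha> i = 2"
  by (simp add: root_inner)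

lemma root_gram:
  "\<alpha> 1 \<bullet> \<alpha> 1 = 2" "\<alpha> 1 \<bullet> \<alpha> 2 = 0" "\<alpha> 1 \<bullet> \<alpha> 3 = -1" "\<alpha> 1 \<bullet> \<alpha> 4 = 0" "\<alpha> 1 \<bullet> \<alpha> 5 = 0" "\<alpha> 1 \<bullet> \<alpha> 6 = 0"
  "\<alpha> 2 \<bullet> \<alpha> 1 = 0" "\<alpha> 2 \<bullet> \<alpha> 2 = 2" "\<alpha> 2 \<bullet> \<alpha> 3 = 0" "\<alpha> 2 \<bullet> \<alpha> 4 = -1" "\<alpha> 2 \<bullet> \<alpha> 5 = 0" "\<alpha> 2 \<bullet> \<alpha> 6 = 0"
  "\<alpha> 3 \<bullet> \<alpha> 1 = -1" "\<alpha> 3 \<bullet> \<alpha> 2 = 0" "\<alpha> 3 \<bullet> \<alpha> 3 = 2" "\<alpha> 3 \<bullet> \<alpha> 4 = -1" "\<alpha> 3 \<bullet> \<alpha> 5 = 0" "\<alpha> 3 \<bullet> \<alpha> 6 = 0"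
  "\<alpha> 4 \<bullet> \<alpha> 1 = 0" "\<alpha> 4 \<bullet> \<alpha> 2 = -1" "\<alpha> 4 \<bullet> \<alpha> 3 = -1" "\<alpha> 4 \<bullet> \<alpha> 4 = 2" "\<alpha> 4 \<bullet> \<alpha> 5 = -1" "\<alpha> 4 \<bullet> \<alpha> 6 = 0"
  "\<alpha> 5 \<bullet> \<alpha> 1 = 0" "\<alpha> 5 \<bullet> \<alpha> 2 = 0" "\<alpha> 5 \<bullet> \<alpha> 3 = 0" "\<alpha> 5 \<bullet> \<alpha> 4 = -1" "\<alpha> 5 \<bullet> \<alpha> 5 = 2" "\<alpha> 5 \<bullet> \<alpha> 6 = -1"
  "\<alpha> 6 \<bullet> \<alpha> 1 = 0" "\<alpha> 6 \<bullet> \<alpha> 2 = 0" "\<alpha> 6 \<bullet> \<alpha> 3 = 0" "\<alpha> 6 \<bullet> \<alpha> 4 = 0" "\<alpha> 6 \<bullet> \<alpha> 5 = -1" "\<alpha> 6 \<bullet> \<alpha> 6 = 2"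
  by (simp_all add: root_inner E6_edges_def doubleton_eq_iff)

text \<open>The fundamental weights; the coefficients are three times the rows of the inverse of the
  Cartan matrix.\<close>

definition \<omega> :: "nat \<Rightarrow> W" where
  "\<omega> i = (1 / 3) *\<^sub>R lincomb \<alpha>
     (if i = 1 then (4, 3, 5, 6, 4, 2)
      else if i = 2 then (3, 6, 6, 9, 6, 3)
      else if i = 3 then (5, 6, 10, 12, 8, 4)
      else if i = 4 then (6, 9, 12, 18, 12, 6)
      else if i = 5 then (4, 6, 8, 12, 10, 5)
      else (2, 3, 4, 6, 5, 4))"

lemma weight_root_inner:
  assumes "i \<in> {1..6}" "j \<in> {1..6}"
  shows "\<omega> i \<bullet> \<alpha> j = of_bool (i = j)"
proof -
  have "i \<in> {1, 2, 3, 4, 5, 6}" "j \<in> {1, 2, 3, 4, 5, 6}"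
    using assms nodes by auto
  then show ?thesis
    by (elim insertE emptyE;
        simp add: \<omega>_def lincomb_def inner_add_left root_gram)
qed

text \<open>Pairing a vanishing combination with \<open>\<omega> i\<close> isolates its i-th
  coefficient, so the six roots are independent in a space of dimension 6.\<close>

lemma span_roots: "span (\<alpha> ` {1..6}) = UNIV"
proof -
  have inj: "inj_on \<alpha> {1..6}"
  proof
    fix i j assume "i \<in> {1..6}" "j \<in> {1..6}" "\<alpha> i = \<alpha> j"
    then show "i = j"
      using weight_root_inner[of i i] weight_root_inner[of i j] by (auto split: if_splits)
  qed
  have "independent (\<alpha> ` {1..6})"
  proof (rule independent_if_scalars_zero)
    fix f x assume sum: "(\<Sum>x\<in>\<alpha> ` {1..6}. f x *\<^sub>R x) = 0" and "x \<in> \<alpha> ` {1..6}"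
    then obtain i where i: "i \<in> {1..6}" "x = \<alpha> i" by auto
    have "0 = \<omega> i \<bullet> (\<Sum>x\<in>\<alpha> ` {1..6}. f x *\<^sub>R x)" by (simp only: sum inner_zero_right)
    also have "\<dots> = (\<Sum>j\<in>{1..6}. f (\<alpha> j) * (\<omega> i \<bullet> \<alpha> j))"
      by (simp add: sum.reindex[OF inj] inner_sum_right)
    also have "\<dots> = (\<Sum>j\<in>{1..6}. if i = j then f (\<alpha> j) else 0)"
      using i by (intro sum.cong) (auto simp: weight_root_inner)
    also have "\<dots> = f x" using i by simp
    finally show "f x = 0" by simp
  qed simp
  moreover have "dim (UNIV :: W set) \<le> card (\<alpha> ` {1..6})"
    by (simp add: card_image[OF inj])
  ultimately show ?thesis
    using card_ge_dim_independent[of "\<alpha> ` {1..6}" UNIV] by auto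
qed

lemma zero_if_orthogonal_roots:
  assumes "\<And>i. i \<in> {1..6} \<Longrightarrow> x \<bullet> \<alpha> i = 0"
  shows "x = 0"
proof -
  have "x \<in> span (\<alpha> ` {1..6})" by (simp add: span_roots)
  moreover have "orthogonal x y" if "y \<in> \<alpha> ` {1..6}" for y
    using that assms by (auto simp: orthogonal_def)
  ultimately have "orthogonal x x"
    using orthogonal_to_span[of x "\<alpha> ` {1..6}" x] by blast
  then show ?thesis by (simp add: orthogonal_self)
qed

lemma weight_expansion: "x = (\<Sum>i\<in>{1..6}. (x \<bullet> \<alpha> i) *\<^sub>R \<omega> i)"
proof -
  have "x - (\<Sum>i\<in>{1..6}. (x \<bullet> \<alpha> i) *\<^sub>R \<omega> i) = 0"
  proof (rule zero_if_orthogonal_roots)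
    fix j :: nat assume j: "j \<in> {1..6}"
    have "(\<Sum>i\<in>{1..6}. (x \<bullet> \<alpha> i) * (\<omega> i \<bullet> \<alpha> j)) = (\<Sum>i\<in>{1..6}. if i = j then x \<bullet> \<alpha> i else 0)"
      using j by (intro sum.cong) (auto simp: weight_root_inner)
    with j show "(x - (\<Sum>i\<in>{1..6}. (x \<bullet> \<alpha> i) *\<^sub>R \<omega> i)) \<bullet> \<alpha> j = 0"
      by (simp add: inner_diff_left inner_sum_left)
  qed
  then show ?thesis by simp
qed

lemma zero_if_orthogonal_weights:
  assumes "\<And>i. i \<in> {1..6} \<Longrightarrow> \<omega> i \<bullet> x = 0"
  shows "x = 0"
proof -
  have "x \<bullet> x = (\<Sum>i\<in>{1..6}. (x \<bullet> \<alpha> i) * (\<omega> i \<bullet> x))"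
    by (subst (1) weight_expansion) (simp add: inner_sum_left)
  then show ?thesis using assms by simp
qed

section \<open>The group and its action on coordinates\<close>

abbreviation G where "G \<equiv> weyl_group \<alpha>"

lemma simple_reflection_in_G: "i \<in> {1..6} \<Longrightarrow> reflection (\<alpha> i) \<in> G"
  using weyl_group.comp[OF _ weyl_group.id] by fastforce

lemma G_linear: "g \<in> G \<Longrightarrow> linear g"
  by (induction rule: weyl_group.induct) (rule linear_id, rule linear_compose[OF _ reflection_linear])

lemma G_inner: "g \<in> G \<Longrightarrow> g x \<bullet> g y = x \<bullet> y"
  by (induction rule: weyl_group.induct) auto

lemma G_comp: "g \<in> G \<Longrightarrow> h \<in> G \<Longrightarrow> g \<circ> h \<in> G"
  by (induction rule: weyl_group.induct) (auto simp: comp_assoc intro: weyl_group.comp)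

lemma G_inverse: "g \<in> G \<Longrightarrow> \<exists>h\<in>G. (\<forall>x. h (g x) = x) \<and> (\<forall>x. g (h x) = x)"
proof (induction rule: weyl_group.induct)
  case id
  then show ?case by (auto intro!: bexI[of _ id] weyl_group.id)
next
  case (comp i g)
  then obtain h where "h \<in> G" "\<And>x. h (g x) = x" "\<And>x. g (h x) = x" by blast
  with comp(1) show ?case
    by (auto intro!: bexI[of _ "h \<circ> reflection (\<alpha> i)"] G_comp simple_reflection_in_G)
qed

lemma simple_reflection: "i \<in> {1..6} \<Longrightarrow> reflection (\<alpha> i) x = x - (x \<bullet> \<alpha> i) *\<^sub>R \<alpha> i"
  by (simp add: reflection_def root_inner_self)

lemma lincomb_inner:
  "lincomb \<omega> (a, b, c, d, e, f) \<bullet> \<alpha> 1 = a" "lincomb \<omega> (a, b, c, d, e, f) \<bullet> \<alpha> 2 = b"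
  "lincomb \<omega> (a, b, c, d, e, f) \<bullet> \<alpha> 3 = c" "lincomb \<omega> (a, b, c, d, e, f) \<bullet> \<alpha> 4 = d"
  "lincomb \<omega> (a, b, c, d, e, f) \<bullet> \<alpha> 5 = e" "lincomb \<omega> (a, b, c, d, e, f) \<bullet> \<alpha> 6 = f"
  by (simp_all add: lincomb_def inner_add_left weight_root_inner)

lemma eq_if_inner_roots:
  assumes "\<And>i. i \<in> {1..6} \<Longrightarrow> x \<bullet> \<alpha> i = y \<bullet> \<alpha> i"
  shows "x = y"
  using zero_if_orthogonal_roots[of "x - y"] assms by (simp add: inner_diff_left)

lemma inj_lincomb: "inj (lincomb \<omega>)"
proof
  fix u v assume "lincomb \<omega> u = lincomb \<omega> v"
  then have "lincomb \<omega> u \<bullet> \<alpha> i = lincomb \<omega> v \<bullet> \<alpha> i" for i by simp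
  from this[of 1] this[of 2] this[of 3] this[of 4] this[of 5] this[of 6] show "u = v"
    by (cases u; cases v) (simp only: lincomb_inner of_int_eq_iff)
qed

lemma reflection_lincomb_weights:
  assumes "i \<in> {1..6}"
  shows "reflection (\<alpha> i) (lincomb \<omega> v) = lincomb \<omega> (weight_refl i v)"
proof (rule eq_if_inner_roots)
  fix j :: nat assume "j \<in> {1..6}"
  with assms have "i \<in> {1, 2, 3, 4, 5, 6}" "j \<in> {1, 2, 3, 4, 5, 6}"
    using nodes by auto
  then show "reflection (\<alpha> i) (lincomb \<omega> v) \<bullet> \<alpha> j = lincomb \<omega> (weight_refl i v) \<bullet> \<alpha> j"
    by (cases v) (elim insertE emptyE;
      simp add: simple_reflection inner_diff_left lincomb_inner weight_refl_def root_gram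
       )
qed

lemma reflection_lincomb_roots:
  assumes "i \<in> {1..6}"
  shows "reflection (\<alpha> i) (lincomb \<alpha> v) = lincomb \<alpha> (root_refl i v)"
proof (rule eq_if_inner_roots)
  fix j :: nat assume "j \<in> {1..6}"
  with assms have "i \<in> {1, 2, 3, 4, 5, 6}" "j \<in> {1, 2, 3, 4, 5, 6}"
    using nodes by auto
  then show "reflection (\<alpha> i) (lincomb \<alpha> v) \<bullet> \<alpha> j = lincomb \<alpha> (root_refl i v) \<bullet> \<alpha> j"
    by (cases v) (elim insertE emptyE;
      simp add: simple_reflection inner_diff_left inner_add_left lincomb_def root_refl_def
        root_gram)
qed

lemma lincomb_unit: "i \<in> {1..6} \<Longrightarrow> lincomb b (unit_coords i) = b i"
  unfolding nodes by (elim insertE emptyE; simp add: lincomb_def unit_coords_def)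

lemma lincomb_add: "lincomb b (add_coords u v) = lincomb b u + lincomb b v"
  by (cases u; cases v) (simp add: lincomb_def add_coords_def algebra_simps)

end

section \<open>Moments of the Gram matrix\<close>

definition gram_diff :: "V \<Rightarrow> real" where
  "gram_diff M = fst M \<bullet> fst M - snd M \<bullet> snd M"

definition gram_off :: "V \<Rightarrow> real" where
  "gram_off M = fst M \<bullet> snd M"

lemma integral_sphere_V_orthogonal:
  fixes f :: "V \<Rightarrow> V" and h :: "V \<Rightarrow> real"
  assumes "orthogonal_transformation f" "continuous_on UNIV h"
  shows "(\<integral>M. h (f M) \<partial>sphere_measure) = (\<integral>M. h M \<partial>sphere_measure)"
proof (rule integral_sphere_measure_orthogonal[where f = f and h = h])
  show "distr lborel borel f = lborel"
    by (rule lborel_distr_orthogonal[where 'n = 12, OF assms(1)]) simp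
qed (fact assms)+

lemma integral_sphere_V_swap:
  fixes h :: "V \<Rightarrow> real"
  assumes "continuous_on UNIV h"
  shows "(\<integral>M. h (snd M, fst M) \<partial>sphere_measure) = (\<integral>M. h M \<partial>sphere_measure)"
  by (rule integral_sphere_V_orthogonal[OF _ assms])
    (auto simp: orthogonal_transformation_def linear_iff)

lemma integral_sphere_V_reflection:
  fixes h :: "V \<Rightarrow> real"
  assumes "continuous_on UNIV h"
  shows "(\<integral>M. h (fst M, reflection a (snd M)) \<partial>sphere_measure) = (\<integral>M. h M \<partial>sphere_measure)"
  by (rule integral_sphere_V_orthogonal[OF _ assms])
    (auto simp: orthogonal_transformation_def linear_iff linear_add[OF reflection_linear]
      linear_scale[OF reflection_linear])

text \<open>This mixing of the columns carries \<open>gram_diff\<close> to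
  \<open>2 * gram_off\<close>, which ties their second moments together.\<close>

lemma integral_sphere_V_rotation:
  fixes h :: "V \<Rightarrow> real"
  assumes "continuous_on UNIV h"
  shows "(\<integral>M. h ((1 / sqrt 2) *\<^sub>R (fst M + snd M), (1 / sqrt 2) *\<^sub>R (fst M - snd M)) \<partial>sphere_measure)
    = (\<integral>M. h M \<partial>sphere_measure)"
proof (rule integral_sphere_V_orthogonal[OF _ assms])
  let ?T = "\<lambda>M::V. ((1 / sqrt 2) *\<^sub>R (fst M + snd M), (1 / sqrt 2) *\<^sub>R (fst M - snd M))"
  have "linear ?T"
    by (simp add: linear_iff scaleR_add_right scaleR_diff_right)
  moreover have "?T M \<bullet> ?T N = M \<bullet> N" for M N
  proof -
    have "?T M \<bullet> ?T N = (1 / sqrt 2) * (1 / sqrt 2) *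
        ((fst M + snd M) \<bullet> (fst N + snd N) + (fst M - snd M) \<bullet> (fst N - snd N))"
      by (simp add: inner_prod_def add_divide_distrib)
    also have "\<dots> = M \<bullet> N"
      by (simp add: inner_prod_def inner_add_left inner_add_right inner_diff_left inner_diff_right)
    finally show ?thesis .
  qed
  ultimately show "orthogonal_transformation ?T"
    by (simp add: orthogonal_transformation_def)
qed

lemma continuous_gram: "continuous_on UNIV gram_diff" "continuous_on UNIV gram_off"
  unfolding gram_diff_def[abs_def] gram_off_def[abs_def] by (auto intro!: continuous_intros)

lemma integral_gram_diff: "(\<integral>M. gram_diff M \<partial>sphere_measure) = 0"
proof -
  have "gram_diff (snd M, fst M) = - gram_diff M" for M
    by (simp add: gram_diff_def)
  then show ?thesis
    using integral_sphere_V_swap[OF continuous_gram(1)] by simp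
qed

lemma reflection_basis:
  fixes b c :: "'a::euclidean_space"
  assumes "b \<in> Basis" "c \<in> Basis"
  shows "reflection c x \<bullet> b = (if b = c then - (x \<bullet> b) else x \<bullet> b)"
  using assms by (auto simp: reflection_def inner_diff_left inner_Basis)

text \<open>Exchanging two coordinates of one column alone is an isometry of \<open>V\<close>; it
  makes fourth moments independent of the coordinates chosen.\<close>

lemma reflection_swap_basis:
  fixes b c :: "'a::euclidean_space"
  assumes "b \<in> Basis" "c \<in> Basis"
  shows "reflection (b - c) x \<bullet> b = x \<bullet> c"
proof (cases "b = c")
  case False
  with assms have "reflection (b - c) c = b"
    by (simp add: reflection_def inner_diff_left inner_diff_right inner_Basis)
  then show ?thesis
    using reflection_inner[of "b - c" x c] by simp
qed (simp add: reflection_def)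

text \<open>Changing the sign of the second column fixes \<open>gram_diff\<close> and negates
  \<open>gram_off\<close>. Taking \<open>h\<close> constant or the identity gives the two vanishing
  moments.\<close>

lemma integral_gram_off_odd:
  fixes h :: "real \<Rightarrow> real"
  assumes "continuous_on UNIV h"
  shows "(\<integral>M. h (gram_diff M) * gram_off M \<partial>sphere_measure) = 0"
proof -
  let ?T = "\<lambda>M::V. (fst M, - snd M)"
  have T: "orthogonal_transformation ?T"
    by (auto simp: orthogonal_transformation_def linear_iff)
  have "continuous_on UNIV (\<lambda>M. h (gram_diff M) * gram_off M)"
    by (intro continuous_on_mult continuous_gram continuous_on_compose2[OF assms continuous_gram(1)])
      simp
  from integral_sphere_V_orthogonal[OF T this] show ?thesis
    by (simp add: gram_diff_def gram_off_def)
qed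

lemma integral_gram_off: "(\<integral>M. gram_off M \<partial>sphere_measure) = 0"
  using integral_gram_off_odd[of "\<lambda>_. 1"] by simp

lemma integral_gram_diff_off: "(\<integral>M. gram_diff M * gram_off M \<partial>sphere_measure) = 0"
  using integral_gram_off_odd[of "\<lambda>x. x"] by simp

text \<open>By symmetry all moments of
  \<open>(fst M \<bullet> b)\<^sup>2 * (snd M \<bullet> c)\<^sup>2\<close> share one value
  \<open>\<beta>\<close>. The square of \<open>gram_off\<close> integrates to
  \<open>6 * \<beta>\<close>, that of \<open>gram_diff\<close> to \<open>24 * \<beta>\<close> and
  the product of the squared column lengths to \<open>36 * \<beta>\<close>; integrating
  \<open>(M \<bullet> M)\<^sup>2\<close> then gives \<open>168 * \<beta> = 1\<close>.\<close>

lemma integral_gram_squares: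
  "(\<integral>M. (gram_diff M)\<^sup>2 \<partial>sphere_measure) = 1 / 7"
  "(\<integral>M. (gram_off M)\<^sup>2 \<partial>sphere_measure) = 1 / 28"
proof -
  let ?I = "\<lambda>h::V \<Rightarrow> real. \<integral>M. h M \<partial>sphere_measure"
  let ?f = "\<lambda>b c M::V. (fst M \<bullet> b)\<^sup>2 * (snd M \<bullet> c)\<^sup>2"
  define m where "m b c = ?I (?f b c)" for b c
  have cont: "continuous_on UNIV (?f b c)" for b c
    by (auto intro!: continuous_intros)
  have m_right: "m b c = m b d" if "c \<in> Basis" "d \<in> Basis" for b c d
    using integral_sphere_V_reflection[OF cont[of b c], of "c - d"] that
    by (simp add: m_def reflection_swap_basis)
  have m_sym: "m b c = m c b" for b c
    using integral_sphere_V_swap[OF cont[of b c]] by (simp add: m_def mult.commute)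
  define \<beta> where "\<beta> = m (axis 1 1) (axis 1 1)"
  have e: "axis 1 1 \<in> (Basis :: W set)" by simp
  have m: "m b c = \<beta>" if "b \<in> Basis" "c \<in> Basis" for b c
    using m_right[OF that(2) e, of b] m_sym[of b "axis 1 1"] m_right[OF that(1) e, of "axis 1 1"]
    by (simp add: \<beta>_def)
  let ?g = "\<lambda>b c M::V. (fst M \<bullet> b) * (snd M \<bullet> b) * ((fst M \<bullet> c) * (snd M \<bullet> c))"
  have contg: "continuous_on UNIV (?g b c)" for b c
    by (auto intro!: continuous_intros)
  have g: "?I (?g b c) = (if b = c then \<beta> else 0)" if "b \<in> Basis" "c \<in> Basis" for b c
  proof (cases "b = c")
    case True
    then have "?g b c = ?f b b" by (auto simp: fun_eq_iff power2_eq_square)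
    then show ?thesis using m[OF that(1,1)] True by (simp add: m_def)
  next
    case False
    \<comment> \<open>Negating the c-th coordinate of the second column negates
      \<open>?g b c\<close>.\<close>
    then show ?thesis
      using integral_sphere_V_reflection[OF contg[of b c], of c] that
      by (simp add: reflection_basis)
  qed
  have "(gram_off M)\<^sup>2 = (\<Sum>b\<in>Basis. \<Sum>c\<in>Basis. ?g b c M)" for M
    unfolding gram_off_def euclidean_inner[of "fst M" "snd M"] power2_eq_square sum_product ..
  then have "?I (\<lambda>M. (gram_off M)\<^sup>2) = (\<Sum>b\<in>Basis. \<Sum>c\<in>Basis. ?I (?g b c))"
    using contg by (simp add: Bochner_Integration.integral_sum integrable_sphere_measure
        Bochner_Integration.integrable_sum)
  also have "\<dots> = (\<Sum>b\<in>(Basis::W set). \<beta>)"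
    by (simp add: g)
  finally have off: "?I (\<lambda>M. (gram_off M)\<^sup>2) = 6 * \<beta>" by simp
  let ?p = "\<lambda>M::V. (fst M \<bullet> fst M) * (snd M \<bullet> snd M)"
  have "?p M = (\<Sum>b\<in>Basis. \<Sum>c\<in>Basis. ?f b c M)" for M
    unfolding euclidean_inner[of "fst M" "fst M"] euclidean_inner[of "snd M" "snd M"]
      power2_eq_square sum_product ..
  then have "?I ?p = (\<Sum>b\<in>Basis. \<Sum>c\<in>Basis. m b c)"
    using cont by (simp add: m_def Bochner_Integration.integral_sum integrable_sphere_measure
        Bochner_Integration.integrable_sum)
  also have "\<dots> = (\<Sum>b\<in>(Basis::W set). \<Sum>c\<in>(Basis::W set). \<beta>)"
    by (simp add: m)
  finally have p: "?I ?p = 36 * \<beta>" by simp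
  have diff: "?I (\<lambda>M. (gram_diff M)\<^sup>2) = 4 * ?I (\<lambda>M. (gram_off M)\<^sup>2)"
  proof -
    have "gram_diff ((1 / sqrt 2) *\<^sub>R (fst M + snd M), (1 / sqrt 2) *\<^sub>R (fst M - snd M))
      = 2 * gram_off M" for M
      by (simp add: gram_diff_def gram_off_def inner_simps inner_commute[of "snd M" "fst M"]
          field_simps)
    then show ?thesis
      using integral_sphere_V_rotation[of "\<lambda>M. (gram_diff M)\<^sup>2"] continuous_gram
      by (simp add: continuous_on_power power_mult_distrib)
  qed
  have "(M \<bullet> M)\<^sup>2 = (gram_diff M)\<^sup>2 + 4 * ?p M" for M
    by (cases M) (simp add: gram_diff_def power2_eq_square algebra_simps)
  moreover have "integrable sphere_measure (\<lambda>M. (gram_diff M)\<^sup>2)"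
    by (intro integrable_sphere_measure continuous_on_power continuous_gram)
  moreover have "integrable sphere_measure ?p"
    by (intro integrable_sphere_measure continuous_intros)
  ultimately have "1 = ?I (\<lambda>M. (gram_diff M)\<^sup>2) + 4 * ?I ?p"
    using integral_sphere_measure_norm[where 'a = V] by simp
  then have "\<beta> = 1 / 168" using off diff p by simp
  then show "?I (\<lambda>M. (gram_diff M)\<^sup>2) = 1 / 7" "?I (\<lambda>M. (gram_off M)\<^sup>2) = 1 / 28"
    using off diff by simp_all
qed

text \<open>Both entries have the form \<open>M \<bullet> T M\<close> with \<open>T\<close> linear;
  \<open>T\<close> may be asymmetric, so \<open>(snd M, 0)\<close> serves for the mixed
  term.\<close>

lemma polynomial_gram:
  assumes "2 \<le> t"
  shows "polynomial_of_degree_le t gram_diff" "polynomial_of_degree_le t gram_off"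
proof -
  have "polynomial_of_degree_le t (\<lambda>M::V. M \<bullet> (fst M, - snd M))"
    by (intro polynomial_of_degree_le_quadratic assms) (auto simp: linear_iff)
  then show "polynomial_of_degree_le t gram_diff"
    by (simp add: gram_diff_def[abs_def] inner_prod_def)
  have "polynomial_of_degree_le t (\<lambda>M::V. M \<bullet> (snd M, 0))"
    by (intro polynomial_of_degree_le_quadratic assms) (auto simp: linear_iff)
  then show "polynomial_of_degree_le t gram_off"
    by (simp add: gram_off_def[abs_def] inner_prod_def)
qed

lemma polynomial_gram_products:
  "polynomial_of_degree_le 4 (\<lambda>M. (gram_diff M)\<^sup>2)"
  "polynomial_of_degree_le 4 (\<lambda>M. (gram_off M)\<^sup>2)"
  "polynomial_of_degree_le 4 (\<lambda>M. gram_diff M * gram_off M)"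
proof -
  have lin: "linear (\<lambda>M::V. (fst M, - snd M))" "linear (\<lambda>M::V. (snd M, 0 :: W))"
    by (auto simp: linear_iff)
  show "polynomial_of_degree_le 4 (\<lambda>M. (gram_diff M)\<^sup>2)"
    using polynomial_of_degree_le_quartic[OF lin(1) lin(1)]
    by (simp add: gram_diff_def inner_prod_def power2_eq_square)
  show "polynomial_of_degree_le 4 (\<lambda>M. (gram_off M)\<^sup>2)"
    using polynomial_of_degree_le_quartic[OF lin(2) lin(2)]
    by (simp add: gram_off_def inner_prod_def power2_eq_square)
  show "polynomial_of_degree_le 4 (\<lambda>M. gram_diff M * gram_off M)"
    using polynomial_of_degree_le_quartic[OF lin(1) lin(2)]
    by (simp add: gram_diff_def gram_off_def inner_prod_def)
qed

section \<open>Orbits of the Weyl group\<close>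

context e6_system
begin

definition dominant :: "W \<Rightarrow> bool" where
  "dominant x \<longleftrightarrow> (\<forall>i\<in>{1..6}. 0 \<le> x \<bullet> \<alpha> i)"

text \<open>Since \<open>\<omega>\<close> is the basis dual to \<open>\<alpha>\<close>, this is the cone of nonnegative combinations of the
  simple roots.\<close>

definition root_cone :: "W set" where
  "root_cone = {x. \<forall>i\<in>{1..6}. 0 \<le> \<omega> i \<bullet> x}"

definition positive_roots :: "W set" where
  "positive_roots = lincomb \<alpha> ` set positive_root_coords"

lemma simple_root_positive: "i \<in> {1..6} \<Longrightarrow> \<alpha> i \<in> positive_roots"
  using unit_coords_in_positive_root_coords lincomb_unit[of i \<alpha>]
  unfolding nodes(2) positive_roots_def by (metis image_eqI)

lemma reflection_positive_roots:
  assumes "\<beta> \<in> positive_roots" "i \<in> {1..6}" "\<beta> \<noteq> \<alpha> i"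
  shows "reflection (\<alpha> i) \<beta> \<in> positive_roots"
proof -
  obtain v where v: "v \<in> set positive_root_coords" "\<beta> = lincomb \<alpha> v"
    using assms(1) by (auto simp: positive_roots_def)
  have "v \<noteq> unit_coords i"
    using assms v lincomb_unit[of i \<alpha>] by auto
  then have "root_refl i v \<in> set positive_root_coords"
    using positive_root_coords_refl v(1) assms(2) unfolding nodes(2) by blast
  then show ?thesis
    using reflection_lincomb_roots[OF assms(2)] v(2) by (auto simp: positive_roots_def)
qed

lemma positive_roots_in_cone:
  assumes "\<beta> \<in> positive_roots"
  shows "\<beta> \<in> root_cone"
proof -
  obtain a b c d e f where v: "(a, b, c, d, e, f) \<in> set positive_root_coords"
    "\<beta> = lincomb \<alpha> (a, b, c, d, e, f)"
    using assms by (auto simp: positive_roots_def)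
  with positive_root_coords_nonneg
  have "0 \<le> a \<and> 0 \<le> b \<and> 0 \<le> c \<and> 0 \<le> d \<and> 0 \<le> e \<and> 0 \<le> f" by fastforce
  then show ?thesis
    unfolding root_cone_def v(2) nodes
    by (simp add: lincomb_def inner_add_right weight_root_inner)
qed

section \<open>Words, the exchange condition and stabilizers\<close>

definition word :: "nat list \<Rightarrow> W \<Rightarrow> W" where
  "word is x = foldr (\<lambda>i. reflection (\<alpha> i)) is x"

lemma word_simps [simp]:
  "word [] x = x" "word (i # is) x = reflection (\<alpha> i) (word is x)"
  "word (is @ js) x = word is (word js x)"
  by (simp_all add: word_def)

lemma word_in_G: "set is \<subseteq> {1..6} \<Longrightarrow> word is \<in> G"
proof (induction "is")
  case Nil
  then show ?case using weyl_group.id by (simp add: word_def[abs_def] id_def)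
next
  case (Cons i "is")
  then have "reflection (\<alpha> i) \<circ> word is \<in> G"
    by (intro weyl_group.comp) auto
  then show ?case by (simp add: o_def word_def[abs_def])
qed

lemma G_word: "g \<in> G \<Longrightarrow> \<exists>is. set is \<subseteq> {1..6} \<and> g = word is"
proof (induction rule: weyl_group.induct)
  case id
  show ?case by (rule exI[of _ "[]"]) (auto simp: fun_eq_iff)
next
  case (comp i g)
  then obtain "is" where "set is \<subseteq> {1..6}" "g = word is" by blast
  with comp(1) show ?case
    by (intro exI[of _ "i # is"]) (auto simp: fun_eq_iff)
qed

text \<open>Letters act from the right. A simple reflection expels only its own root from the
  positive roots, so wherever the image exits, the current root is \<open>\<alpha> k\<close>, with
  \<open>ks\<close> the letters already applied.\<close>

lemma word_leaves_positive_roots: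
  assumes "\<beta> \<in> positive_roots" "set is \<subseteq> {1..6}" "word is \<beta> \<notin> positive_roots"
  shows "\<exists>js k ks. is = js @ k # ks \<and> word ks \<beta> = \<alpha> k"
  using assms(2,3)
proof (induction "is")
  case Nil
  then show ?case using assms(1) by simp
next
  case (Cons i "is")
  show ?case
  proof (cases "word is \<beta> \<in> positive_roots")
    case True
    then have "word is \<beta> = \<alpha> i"
      using Cons.prems reflection_positive_roots by auto
    then show ?thesis by blast
  next
    case False
    then obtain js k ks where "is = js @ k # ks" "word ks \<beta> = \<alpha> k"
      using Cons by auto
    then show ?thesis by (intro exI[of _ "i # js"]) auto
  qed
qed

text \<open>Induction on the length of a word: either its last letter sends a simple root to a positive
  root, or the word can be shortened by the exchange condition.\<close>

lemma dominant_minus_word_in_cone: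
  assumes "dominant x"
  shows "set is \<subseteq> {1..6} \<Longrightarrow> x - word is x \<in> root_cone"
proof (induction "is" rule: length_induct)
  case (1 "is")
  show ?case
  proof (cases "is" rule: rev_cases)
    case Nil
    then show ?thesis by (simp add: root_cone_def)
  next
    case (snoc js i)
    have i: "i \<in> {1..6}" and js: "set js \<subseteq> {1..6}"
      using 1 snoc by auto
    show ?thesis
    proof (cases "word js (\<alpha> i) \<in> positive_roots")
      case True
      have "x - word js x \<in> root_cone"
        using 1 js snoc by simp
      moreover have "word js (\<alpha> i) \<in> root_cone"
        using True by (rule positive_roots_in_cone)
      moreover have eq: "x - word is x = (x - word js x) + (x \<bullet> \<alpha> i) *\<^sub>R word js (\<alpha> i)"
        using i G_linear[OF word_in_G[OF js]]
        by (simp add: snoc simple_reflection linear_diff linear_scale)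
      moreover have "0 \<le> x \<bullet> \<alpha> i"
        using assms i by (simp add: dominant_def)
      ultimately show ?thesis
        unfolding eq by (simp add: root_cone_def inner_add_right)
    next
      case False
      then obtain as k bs where js_eq: "js = as @ k # bs" and k: "word bs (\<alpha> i) = \<alpha> k"
        using word_leaves_positive_roots[OF simple_root_positive[OF i] js] by blast
      have bs: "word bs \<in> G" using js js_eq by (intro word_in_G) auto
      have "word is x = word as (reflection (\<alpha> k) (word bs (reflection (\<alpha> i) x)))"
        by (simp add: snoc js_eq)
      \<comment> \<open>\<open>word bs\<close> carries \<open>\<alpha> i\<close> to
        \<open>\<alpha> k\<close> and hence conjugates one reflection into the other; the two
        letters \<open>k\<close> cancel, and the word becomes shorter by two.\<close>
      also have "word bs (reflection (\<alpha> i) x) = reflection (\<alpha> k) (word bs x)"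
        by (subst reflection_equivariant[OF G_linear[OF bs] G_inner[OF bs]]) (simp only: k)
      finally have "word is x = word (as @ bs) x" by simp
      moreover have "x - word (as @ bs) x \<in> root_cone"
        using snoc js_eq js by (intro 1(1)[rule_format]) auto
      ultimately show ?thesis by simp
    qed
  qed
qed

lemma dominant_minus_in_cone: "dominant x \<Longrightarrow> g \<in> G \<Longrightarrow> x - g x \<in> root_cone"
  using G_word dominant_minus_word_in_cone by blast

lemma dominant_weight: "i \<in> {1..6} \<Longrightarrow> dominant (\<omega> i)"
  by (auto simp: dominant_def weight_root_inner)

text \<open>In fundamental weights, \<open>x - g x\<close> is the combination of the vectors
  \<open>\<omega> k - g (\<omega> k)\<close> with nonnegative coefficients
  \<open>x \<bullet> \<alpha> k\<close>. These vectors lie in the root cone, which contains no line,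
  so a zero sum forces each one with a positive coefficient to vanish.\<close>

lemma stabilizer_fixes_weight:
  assumes x: "dominant x" and g: "g \<in> G" "g x = x" and j: "j \<in> {1..6}" "0 < x \<bullet> \<alpha> j"
  shows "g (\<omega> j) = \<omega> j"
proof -
  have "\<omega> l \<bullet> (\<omega> j - g (\<omega> j)) = 0" if l: "l \<in> {1..6}" for l
  proof -
    let ?t = "\<lambda>k. (x \<bullet> \<alpha> k) * (\<omega> l \<bullet> (\<omega> k - g (\<omega> k)))"
    have nonneg: "0 \<le> ?t k" if "k \<in> {1..6}" for k
      using that l x dominant_minus_in_cone[OF dominant_weight g(1)]
      by (auto simp: dominant_def root_cone_def)
    have "g x = (\<Sum>k\<in>{1..6}. (x \<bullet> \<alpha> k) *\<^sub>R g (\<omega> k))"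
      by (subst weight_expansion[of x]) (simp add: linear_sum[OF G_linear[OF g(1)]]
          linear_scale[OF G_linear[OF g(1)]])
    then have "x - g x = (\<Sum>k\<in>{1..6}. (x \<bullet> \<alpha> k) *\<^sub>R (\<omega> k - g (\<omega> k)))"
      using weight_expansion[of x] by (simp add: scaleR_diff_right sum_subtractf)
    then have "\<omega> l \<bullet> (x - g x) = (\<Sum>k\<in>{1..6}. ?t k)"
      by (simp add: inner_sum_right)
    then have "(\<Sum>k\<in>{1..6}. ?t k) = 0" using g(2) by simp
    then have "?t j = 0"
      using nonneg j(1) sum_nonneg_eq_0_iff[of "{1..6}" ?t] by fastforce
    then show ?thesis using j(2) by simp
  qed
  then have "\<omega> j - g (\<omega> j) = 0" by (rule zero_if_orthogonal_weights)
  then show ?thesis by simp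
qed

section \<open>Sizes of orbits in \<open>W\<close>\<close>

definition orbit :: "W \<Rightarrow> W set" where
  "orbit x = (\<lambda>g. g x) ` G"

lemma orbit_image:
  assumes "g \<in> G"
  shows "orbit (g x) = orbit x"
proof -
  obtain h where h: "h \<in> G" "\<And>y. h (g y) = y"
    using G_inverse[OF assms] by blast
  show ?thesis
    unfolding orbit_def
  proof (intro set_eqI iffI)
    fix y assume "y \<in> (\<lambda>k. k (g x)) ` G"
    then obtain k where "k \<in> G" "y = k (g x)" by blast
    then show "y \<in> (\<lambda>k. k x) ` G"
      using G_comp[OF _ assms, of k] by (intro image_eqI[of _ _ "k \<circ> g"]) auto
  next
    fix y assume "y \<in> (\<lambda>k. k x) ` G"
    then obtain k where "k \<in> G" "y = k x" by blast
    then show "y \<in> (\<lambda>k. k (g x)) ` G"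
      using G_comp[OF _ h(1), of k] h(2) by (intro image_eqI[of _ _ "k \<circ> h"]) auto
  qed
qed

text \<open>Sending \<open>g x\<close> to \<open>g y\<close> is well defined by the condition on
  stabilizers, and it maps one orbit onto the other.\<close>

lemma card_orbit_le:
  assumes fin: "finite (orbit x)" and stab: "\<And>g. g \<in> G \<Longrightarrow> g x = x \<Longrightarrow> g y = y"
  shows "finite (orbit y)" "card (orbit y) \<le> card (orbit x)"
proof -
  have eq: "g y = h y" if gh: "g \<in> G" "h \<in> G" "g x = h x" for g h
  proof -
    obtain k where k: "k \<in> G" "\<And>z. k (h z) = z" "\<And>z. h (k z) = z"
      using G_inverse[OF gh(2)] by blast
    have "(k \<circ> g) y = y"
      using gh k by (intro stab G_comp) auto
    then show ?thesis using k(3) by (metis comp_apply)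
  qed
  define f where "f v = (SOME g. g \<in> G \<and> v = g x) y" for v
  have "f (g x) = g y" if "g \<in> G" for g
  proof -
    have "(SOME h. h \<in> G \<and> g x = h x) \<in> G \<and> g x = (SOME h. h \<in> G \<and> g x = h x) x"
      by (rule someI[of _ g]) (use that in simp)
    then show ?thesis
      using eq[OF that, of "SOME h. h \<in> G \<and> g x = h x"] by (simp add: f_def)
  qed
  then have "orbit y = f ` orbit x"
    by (auto simp: orbit_def image_image intro!: image_cong)
  then show "finite (orbit y)" "card (orbit y) \<le> card (orbit x)"
    using fin by (simp_all add: card_image_le)
qed

lemma root_in_orbit_tree: "v \<in> set (orbit_tree n v)"
  by (cases n) auto

lemma orbit_tree_in_orbit:
  "w \<in> set (orbit_tree n v) \<Longrightarrow> lincomb \<omega> w \<in> orbit (lincomb \<omega> v)"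
proof (induction n arbitrary: v)
  case 0
  then show ?case
    using weyl_group.id by (auto simp: orbit_def intro!: image_eqI[of _ _ id])
next
  case (Suc n)
  then consider "w = v" | i where "i \<in> set [1, 2, 3, 4, 5, 6]"
      "w \<in> set (orbit_tree n (weight_refl i v))"
    by (auto split: if_splits)
  then show ?case
  proof cases
    case 1
    then show ?thesis
      using weyl_group.id by (auto simp: orbit_def intro!: image_eqI[of _ _ id])
  next
    case 2
    then have i: "i \<in> {1..6}" by (simp only: nodes)
    with 2 have "lincomb \<omega> w \<in> orbit (reflection (\<alpha> i) (lincomb \<omega> v))"
      using Suc.IH by (simp add: reflection_lincomb_weights)
    then show ?thesis
      using orbit_image simple_reflection_in_G i by blast
  qed
qed

lemma length_orbit_tree_le_card_orbit:
  assumes "finite (orbit (lincomb \<omega> v))"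
  shows "length (orbit_tree n v) \<le> card (orbit (lincomb \<omega> v))"
proof -
  have "length (orbit_tree n v) = card (lincomb \<omega> ` set (orbit_tree n v))"
    by (simp add: card_image inj_on_subset[OF inj_lincomb] distinct_card distinct_orbit_tree)
  also have "\<dots> \<le> card (orbit (lincomb \<omega> v))"
    using assms orbit_tree_in_orbit by (intro card_mono image_subsetI)
  finally show ?thesis .
qed

text \<open>Elements fixing \<open>x\<close> fix \<open>\<omega> i\<close> and
  \<open>\<omega> j\<close>, hence their sum, whose integral coordinates admit enumeration.\<close>

lemma card_orbit_two_positive:
  assumes fin: "finite (orbit x)" and x: "dominant x"
    and "i \<in> {1..6}" "j \<in> {1..6}" "i \<noteq> j" "0 < x \<bullet> \<alpha> i" "0 < x \<bullet> \<alpha> j"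
  shows "270 \<le> card (orbit x)"
  using assms(3-7)
proof (induction i j rule: linorder_wlog)
  case (le i j)
  then have "(i, j) \<in> set (map fst pair_depths)"
    using pair_depths_complete unfolding nodes(2) by simp
  then obtain n where "((i, j), n) \<in> set pair_depths" by auto
  then have *: "270 \<le> length (orbit_tree n (add_coords (unit_coords i) (unit_coords j)))"
    using orbit_tree_pair_count by fastforce
  let ?y = "lincomb \<omega> (add_coords (unit_coords i) (unit_coords j))"
  have y: "?y = \<omega> i + \<omega> j"
    using le by (simp add: lincomb_add lincomb_unit)
  have "g ?y = ?y" if g: "g \<in> G" "g x = x" for g
    using stabilizer_fixes_weight[OF x g] le linear_add[OF G_linear[OF g(1)]]
    by (simp add: y)
  then have "finite (orbit ?y)" "card (orbit ?y) \<le> card (orbit x)"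
    using card_orbit_le[OF fin, of ?y] by blast+
  then show ?case
    using * length_orbit_tree_le_card_orbit[of "add_coords (unit_coords i) (unit_coords j)" n]
    by linarith
next
  case (sym i j)
  then show ?case by auto
qed

lemma card_orbit_inner_node:
  assumes fin: "finite (orbit x)" and x: "dominant x"
    and j: "j \<in> {2..5}" "0 < x \<bullet> \<alpha> j"
  shows "55 \<le> card (orbit x)"
proof -
  have "j \<in> set [2, 3, 4, 5]" "j \<in> {1..6}" using j by auto
  then have *: "55 \<le> length (orbit_tree 14 (unit_coords j))"
    using orbit_tree_single_count by blast
  let ?y = "lincomb \<omega> (unit_coords j)"
  have "g ?y = ?y" if "g \<in> G" "g x = x" for g
    using stabilizer_fixes_weight[OF x that] j \<open>j \<in> {1..6}\<close> by (simp add: lincomb_unit)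
  then have "finite (orbit ?y)" "card (orbit ?y) \<le> card (orbit x)"
    using card_orbit_le[OF fin, of ?y] by blast+
  then show ?thesis
    using * length_orbit_tree_le_card_orbit[of "unit_coords j" 14] by linarith
qed

lemma card_orbit_minuscule:
  assumes i: "i \<in> {1, 6}"
  shows "card (orbit (\<omega> i)) = 27"
proof -
  let ?L = "orbit_tree 16 (unit_coords i)"
  have i': "i \<in> set [1, 6]" "i \<in> {1..6}" using i by auto
  have len: "length ?L = 27" and closed: "refl_closed ?L"
    using length_orbit_tree_minuscule refl_closed_orbit_tree_minuscule i' by blast+
  have \<omega>: "\<omega> i = lincomb \<omega> (unit_coords i)"
    using i' by (simp add: lincomb_unit)
  have "\<omega> i \<in> lincomb \<omega> ` set ?L"
    unfolding \<omega> by (intro imageI root_in_orbit_tree)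
  have "g (\<omega> i) \<in> lincomb \<omega> ` set ?L" if "g \<in> G" for g
    using that
  proof (induction rule: weyl_group.induct)
    case id
    then show ?case using \<open>\<omega> i \<in> _\<close> by simp
  next
    case (comp k g)
    then obtain v where v: "v \<in> set ?L" "g (\<omega> i) = lincomb \<omega> v" by blast
    then have "weight_refl k v \<in> set ?L"
      using closed comp(1) unfolding refl_closed_def nodes(2) by blast
    then show ?case
      using v(2) comp(1) by (simp add: reflection_lincomb_weights)
  qed
  then have sub: "orbit (\<omega> i) \<subseteq> lincomb \<omega> ` set ?L"
    by (auto simp: orbit_def)
  have fin: "finite (orbit (\<omega> i))"
    using sub by (rule finite_subset) simp
  have "card (orbit (\<omega> i)) \<le> card (lincomb \<omega> ` set ?L)"
    using sub by (intro card_mono) auto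
  also have "\<dots> \<le> 27"
    using card_image_le[of "set ?L" "lincomb \<omega>"] card_length[of ?L] len by simp
  finally show ?thesis
    using length_orbit_tree_le_card_orbit[of "unit_coords i" 16] fin len \<omega> by simp
qed

text \<open>An element maximizing the pairing with the sum of the weights works: that sum pairs to 1
  with each simple root, so reflecting in a negative entry would increase the pairing. The set
  \<open>J\<close> allows dominance with respect to a parabolic subgroup.\<close>

lemma dominant_representative:
  assumes fin: "finite S" and y: "y \<in> S"
    and closed: "\<And>i z. i \<in> J \<Longrightarrow> z \<in> S \<Longrightarrow> reflection (\<alpha> i) z \<in> S"
    and J: "J \<subseteq> {1..6}"
  shows "\<exists>z\<in>S. \<forall>i\<in>J. 0 \<le> z \<bullet> \<alpha> i"
proof -
  let ?\<rho> = "\<Sum>i\<in>{1..6}. \<omega> i"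
  have \<rho>: "?\<rho> \<bullet> \<alpha> j = 1" if "j \<in> {1..6}" for j
  proof -
    have "?\<rho> \<bullet> \<alpha> j = (\<Sum>i\<in>{1..6}. if i = j then 1 else 0)"
      unfolding inner_sum_left using that by (intro sum.cong) (auto simp: weight_root_inner)
    then show ?thesis using that by simp
  qed
  obtain z where z: "z \<in> S" "\<And>w. w \<in> S \<Longrightarrow> ?\<rho> \<bullet> w \<le> ?\<rho> \<bullet> z"
  proof -
    let ?I = "(\<lambda>w. ?\<rho> \<bullet> w) ` S"
    have "Max ?I \<in> ?I" using fin y by (intro Max_in) auto
    then obtain z where "z \<in> S" "Max ?I = ?\<rho> \<bullet> z" by auto
    moreover have "?\<rho> \<bullet> w \<le> Max ?I" if "w \<in> S" for w
      using fin that by (intro Max_ge) auto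
    ultimately show ?thesis using that by metis
  qed
  have "0 \<le> z \<bullet> \<alpha> i" if "i \<in> J" for i
  proof -
    have "?\<rho> \<bullet> reflection (\<alpha> i) z \<le> ?\<rho> \<bullet> z"
      using z closed that by blast
    then show ?thesis
      using that J by (auto simp: simple_reflection inner_diff_right \<rho>)
  qed
  with z(1) show ?thesis by blast
qed

lemma self_in_orbit: "x \<in> orbit x"
  unfolding orbit_def using weyl_group.id by (intro image_eqI[of _ _ id]) auto

lemma reflection_in_orbit: "z \<in> orbit x \<Longrightarrow> i \<in> {1..6} \<Longrightarrow> reflection (\<alpha> i) z \<in> orbit x"
proof -
  assume "z \<in> orbit x" and i: "i \<in> {1..6}"
  then obtain g where "g \<in> G" "z = g x" unfolding orbit_def by blast
  then show ?thesis
    unfolding orbit_def using weyl_group.comp[OF i, of g]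
    by (intro image_eqI[of _ _ "reflection (\<alpha> i) \<circ> g"]) auto
qed

text \<open>A dominant representative positive at one of the nodes 2 to 5 has at least 55 images,
  and one positive at both 1 and 6 at least 270. What remains is a multiple of a minuscule
  weight.\<close>

lemma card_orbit_small:
  assumes fin: "finite (orbit x)" and "x \<noteq> 0" and small: "card (orbit x) \<le> 54"
  shows "card (orbit x) = 27"
proof -
  obtain z where z: "z \<in> orbit x" "\<forall>i\<in>{1..6}. 0 \<le> z \<bullet> \<alpha> i"
    using dominant_representative[OF fin self_in_orbit reflection_in_orbit, of "{1..6}"] by blast
  then obtain g where g: "g \<in> G" "z = g x" by (auto simp: orbit_def)
  have oz: "orbit z = orbit x" using g orbit_image by simp
  have "z \<bullet> z \<noteq> 0" using g G_inner[OF g(1), of x x] \<open>x \<noteq> 0\<close> by simp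
  then have "z \<noteq> 0" by auto
  have dom: "dominant z" using z by (simp add: dominant_def)
  have inner: "z \<bullet> \<alpha> j = 0" if "j \<in> {2..5}" for j
  proof (rule ccontr)
    assume "z \<bullet> \<alpha> j \<noteq> 0"
    moreover have "0 \<le> z \<bullet> \<alpha> j" using z(2) that by simp
    ultimately have "55 \<le> card (orbit x)"
      using card_orbit_inner_node[of z j] that fin dom oz by simp
    then show False using small by simp
  qed
  obtain i k where ik: "i \<in> {1, 6}" "k \<in> {1, 6}" "i \<noteq> k" "z \<bullet> \<alpha> k = 0"
  proof -
    have "z \<bullet> \<alpha> 1 = 0 \<or> z \<bullet> \<alpha> 6 = 0"
    proof (rule ccontr)
      assume "\<not> ?thesis"
      moreover have "0 \<le> z \<bullet> \<alpha> 1" "0 \<le> z \<bullet> \<alpha> 6" using z(2) by simp_all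
      ultimately have "270 \<le> card (orbit x)"
        using card_orbit_two_positive[of z 1 6] fin dom oz by simp
      then show False using small by simp
    qed
    then show ?thesis using that[of 1 6] that[of 6 1] by auto
  qed
  define c where "c = z \<bullet> \<alpha> i"
  have zero: "z \<bullet> \<alpha> j = 0" if "j \<in> {1..6}" "j \<noteq> i" for j
  proof (cases "j \<in> {2..5}")
    case False
    then have "j \<in> {1, 6}" using that by auto
    then show ?thesis using ik that by auto
  qed (rule inner)
  have i: "i \<in> {1..6}" using ik by auto
  have zc: "z = c *\<^sub>R \<omega> i"
    by (rule eq_if_inner_roots) (use zero i in \<open>auto simp: c_def weight_root_inner\<close>)
  then have "c \<noteq> 0" using \<open>z \<noteq> 0\<close> by auto
  have "orbit z = (*\<^sub>R) c ` orbit (\<omega> i)"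
    unfolding orbit_def image_image zc by (intro image_cong) (auto simp: linear_scale[OF G_linear])
  then have "card (orbit z) = card (orbit (\<omega> i))"
    using \<open>c \<noteq> 0\<close> by (simp add: card_image inj_on_def)
  then show ?thesis
    using card_orbit_minuscule ik(1) oz by simp
qed

section \<open>Orbits of pairs of vectors\<close>

lemma weyl_orbit_act:
  assumes "g \<in> G"
  shows "weyl_orbit \<alpha> (act g M) = weyl_orbit \<alpha> M"
proof -
  obtain h where h: "h \<in> G" "\<And>y. h (g y) = y"
    using G_inverse[OF assms] by blast
  show ?thesis
    unfolding weyl_orbit_def
  proof (intro set_eqI iffI)
    fix N assume "N \<in> (\<lambda>k. act k (act g M)) ` G"
    then obtain k where "k \<in> G" "N = act k (act g M)" by blast
    then show "N \<in> (\<lambda>k. act k M) ` G"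
      using G_comp[OF _ assms, of k] by (intro image_eqI[of _ _ "k \<circ> g"]) (auto simp: act_def)
  next
    fix N assume "N \<in> (\<lambda>k. act k M) ` G"
    then obtain k where "k \<in> G" "N = act k M" by blast
    then show "N \<in> (\<lambda>k. act k (act g M)) ` G"
      using G_comp[OF _ h(1), of k] h(2)
      by (intro image_eqI[of _ _ "k \<circ> h"]) (auto simp: act_def)
  qed
qed

lemma self_in_weyl_orbit: "M \<in> weyl_orbit \<alpha> M"
  unfolding weyl_orbit_def using weyl_group.id by (intro image_eqI[of _ _ id]) (auto simp: act_def)

lemma weyl_orbit_eq: "N \<in> weyl_orbit \<alpha> M \<Longrightarrow> weyl_orbit \<alpha> N = weyl_orbit \<alpha> M"
proof -
  assume "N \<in> weyl_orbit \<alpha> M"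
  then obtain g where "g \<in> G" "N = act g M" unfolding weyl_orbit_def by blast
  then show ?thesis by (simp only: weyl_orbit_act)
qed

text \<open>As a linear image of the orbit of the pair, the orbit of any combination of the columns
  bounds its size from below.\<close>

lemma orbit_combination:
  "orbit (a *\<^sub>R x + b *\<^sub>R y) = (\<lambda>M. a *\<^sub>R fst M + b *\<^sub>R snd M) ` weyl_orbit \<alpha> (x, y)"
  unfolding orbit_def weyl_orbit_def image_image
  by (intro image_cong) (auto simp: act_def linear_add[OF G_linear] linear_scale[OF G_linear])

text \<open>It suffices to find a vector in the span of \<open>x\<close> and \<open>y\<close> which has a dominant image with two
  positive coordinates. If the dominant image of \<open>x\<close> lies on a ray of the chamber, perturb it by a
  small multiple of \<open>y\<close>, after making \<open>y\<close> dominant for the stabilizer of \<open>x\<close>.\<close>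

lemma card_weyl_orbit_independent:
  assumes fin: "finite (weyl_orbit \<alpha> (x, y))" and "x \<noteq> 0" and indep: "\<And>t. y \<noteq> t *\<^sub>R x"
  shows "270 \<le> card (weyl_orbit \<alpha> (x, y))"
proof -
  have "orbit x = fst ` weyl_orbit \<alpha> (x, y)"
    using orbit_combination[of 1 x 0 y] by simp
  then have "finite (orbit x)" using fin by simp
  then obtain x' where x': "x' \<in> orbit x" "\<forall>i\<in>{1..6}. 0 \<le> x' \<bullet> \<alpha> i"
    using dominant_representative[OF _ self_in_orbit reflection_in_orbit, of x "{1..6}"] by blast
  then obtain g where g: "g \<in> G" "x' = g x" by (auto simp: orbit_def)
  define y' where "y' = g y"
  have lin: "linear g" using g by (simp add: G_linear)
  have inj: "g u = g v \<Longrightarrow> u = v" if "g \<in> G" for g u v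
    using G_inverse[OF that] by metis
  have indep': "y' \<noteq> t *\<^sub>R x'" for t
    using inj[OF g(1), of y "t *\<^sub>R x"] indep[of t] linear_scale[OF lin, of t x]
    by (auto simp: y'_def g)
  have "x' \<noteq> 0"
    using inj[OF g(1), of x 0] \<open>x \<noteq> 0\<close> linear_0[OF lin] by (auto simp: g)
  have dom: "dominant x'" using x' by (simp add: dominant_def)
  have orb: "weyl_orbit \<alpha> (x', y') = weyl_orbit \<alpha> (x, y)"
    using weyl_orbit_act[OF g(1), of "(x, y)"] by (simp add: act_def g y'_def)
  have "\<exists>a b h i j. h \<in> G \<and> h x' = x' \<and> dominant (a *\<^sub>R x' + b *\<^sub>R h y')
      \<and> i \<in> {1..6} \<and> j \<in> {1..6} \<and> i \<noteq> j
      \<and> 0 < (a *\<^sub>R x' + b *\<^sub>R h y') \<bullet> \<alpha> i \<and> 0 < (a *\<^sub>R x' + b *\<^sub>R h y') \<bullet> \<alpha> j"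
  proof (cases "\<exists>i\<in>{1..6}. \<exists>j\<in>{1..6}. i \<noteq> j \<and> 0 < x' \<bullet> \<alpha> i \<and> 0 < x' \<bullet> \<alpha> j")
    case True
    then obtain i j where "i \<in> {1..6}" "j \<in> {1..6}" "i \<noteq> j" "0 < x' \<bullet> \<alpha> i" "0 < x' \<bullet> \<alpha> j"
      by blast
    then show ?thesis
      using dom weyl_group.id
      by (intro exI[of _ 1] exI[of _ 0] exI[of _ id] exI[of _ i] exI[of _ j]) auto
  next
    case False
    obtain j where j: "j \<in> {1..6}" "x' \<bullet> \<alpha> j \<noteq> 0"
      using zero_if_orthogonal_roots[of x'] \<open>x' \<noteq> 0\<close> by blast
    then have cj: "0 < x' \<bullet> \<alpha> j" using x'(2) by force
    have zero: "x' \<bullet> \<alpha> i = 0" if "i \<in> {1..6}" "i \<noteq> j" for i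
    proof -
      have "\<not> 0 < x' \<bullet> \<alpha> i" using False that j(1) cj by blast
      moreover have "0 \<le> x' \<bullet> \<alpha> i" using x'(2) that(1) by blast
      ultimately show ?thesis by simp
    qed
    \<comment> \<open>Reflections in the simple roots orthogonal to \<open>x'\<close> fix
      \<open>x'\<close>, so they move \<open>y'\<close> within \<open>S\<close>.\<close>
    define S where "S = (\<lambda>h. h y') ` {h \<in> G. h x' = x'}"
    have "S \<subseteq> snd ` weyl_orbit \<alpha> (x', y')"
      by (force simp: S_def weyl_orbit_def act_def)
    then have "finite S" using fin orb by (auto intro: finite_subset)
    moreover have "y' \<in> S"
      unfolding S_def using weyl_group.id by (intro image_eqI[of _ _ id]) auto
    moreover have "reflection (\<alpha> i) z \<in> S" if "i \<in> {1..6} - {j}" "z \<in> S" for i z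
    proof -
      from that(2) obtain h where "h \<in> G" "h x' = x'" "z = h y'" unfolding S_def by blast
      then show ?thesis
        unfolding S_def using that(1) zero weyl_group.comp[of i h]
        by (intro image_eqI[of _ _ "reflection (\<alpha> i) \<circ> h"]) (auto simp: simple_reflection)
    qed
    ultimately obtain z where z: "z \<in> S" "\<And>i. i \<in> {1..6} - {j} \<Longrightarrow> 0 \<le> z \<bullet> \<alpha> i"
      using dominant_representative[of S y' "{1..6} - {j}"] by blast
    from z(1) obtain h where h: "h \<in> G" "h x' = x'" "z = h y'"
      unfolding S_def by blast
    \<comment> \<open>Otherwise \<open>z\<close> and \<open>x'\<close> would both vanish at all
      nodes except \<open>j\<close> and be proportional.\<close>
    have "\<exists>i\<in>{1..6} - {j}. 0 < z \<bullet> \<alpha> i"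
    proof (rule ccontr)
      assume none: "\<not> ?thesis"
      have z0: "z \<bullet> \<alpha> i = 0" if "i \<in> {1..6} - {j}" for i
      proof -
        have "\<not> 0 < z \<bullet> \<alpha> i" using none that by blast
        then show ?thesis using z(2)[OF that] by simp
      qed
      define t where "t = (z \<bullet> \<alpha> j) / (x' \<bullet> \<alpha> j)"
      have "z = t *\<^sub>R x'"
      proof (rule eq_if_inner_roots)
        fix k :: nat assume "k \<in> {1..6}"
        then show "z \<bullet> \<alpha> k = (t *\<^sub>R x') \<bullet> \<alpha> k"
          using z0[of k] zero[of k] j(2) by (cases "k = j") (auto simp: t_def)
      qed
      then have "h y' = h (t *\<^sub>R x')"
        using h linear_scale[OF G_linear[OF h(1)]] by metis
      then show False
        using inj[OF h(1)] indep' by blast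
    qed
    then obtain i where i: "i \<in> {1..6} - {j}" "0 < z \<bullet> \<alpha> i" by blast
    define m where "m = z \<bullet> \<alpha> j"
    define c where "c = x' \<bullet> \<alpha> j"
    \<comment> \<open>The denominator keeps \<open>\<bar>\<epsilon> * m\<bar>\<close> below
      \<open>c\<close>, so entry \<open>j\<close> stays positive whatever the sign of
      \<open>m\<close>; the added 1 covers \<open>m = 0\<close>.\<close>
    define \<epsilon> where "\<epsilon> = c / (1 + \<bar>m\<bar>)"
    have "0 < c" using cj by (simp add: c_def)
    then have \<epsilon>: "0 < \<epsilon>" by (simp add: \<epsilon>_def)
    have "0 < c + \<epsilon> * m"
    proof -
      have "\<bar>\<epsilon> * m\<bar> < c"
        using \<open>0 < c\<close> by (simp add: \<epsilon>_def abs_mult field_simps)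
      then show ?thesis by linarith
    qed
    then have pos_j: "0 < (1 *\<^sub>R x' + \<epsilon> *\<^sub>R h y') \<bullet> \<alpha> j"
      by (simp add: inner_add_left c_def m_def h)
    have pos: "(1 *\<^sub>R x' + \<epsilon> *\<^sub>R h y') \<bullet> \<alpha> k = \<epsilon> * (z \<bullet> \<alpha> k)" if "k \<in> {1..6} - {j}" for k
      using zero[of k] that by (simp add: inner_add_left h)
    have pos_i: "0 < (1 *\<^sub>R x' + \<epsilon> *\<^sub>R h y') \<bullet> \<alpha> i"
      using pos[OF i(1)] i(2) \<epsilon> by simp
    have dom_z: "dominant (1 *\<^sub>R x' + \<epsilon> *\<^sub>R h y')"
      unfolding dominant_def
    proof
      fix k :: nat assume "k \<in> {1..6}"
      then show "0 \<le> (1 *\<^sub>R x' + \<epsilon> *\<^sub>R h y') \<bullet> \<alpha> k"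
        using pos[of k] pos_j z(2)[of k] \<epsilon> by (cases "k = j") auto
    qed
    have "i \<in> {1..6}" "i \<noteq> j" using i(1) by auto
    then show ?thesis
      by (intro exI[of _ 1] exI[of _ \<epsilon>] exI[of _ h] exI[of _ i] exI[of _ j] conjI
          h(1,2) dom_z j(1) pos_i pos_j)
  qed
  then obtain a b h i j where h: "h \<in> G" "h x' = x'" and ij: "i \<in> {1..6}" "j \<in> {1..6}" "i \<noteq> j"
    and dom_z: "dominant (a *\<^sub>R x' + b *\<^sub>R h y')"
    and pos: "0 < (a *\<^sub>R x' + b *\<^sub>R h y') \<bullet> \<alpha> i" "0 < (a *\<^sub>R x' + b *\<^sub>R h y') \<bullet> \<alpha> j"
    by blast
  let ?z = "a *\<^sub>R x' + b *\<^sub>R h y'"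
  have "?z = h (a *\<^sub>R x' + b *\<^sub>R y')"
    using h by (simp add: linear_add[OF G_linear] linear_scale[OF G_linear])
  then have oz: "orbit ?z = (\<lambda>M. a *\<^sub>R fst M + b *\<^sub>R snd M) ` weyl_orbit \<alpha> (x, y)"
    using orbit_image[OF h(1)] orbit_combination[of a x' b y'] orb by simp
  then have "270 \<le> card (orbit ?z)"
    using fin by (intro card_orbit_two_positive[OF _ dom_z ij pos]) simp
  also have "\<dots> \<le> card (weyl_orbit \<alpha> (x, y))"
    unfolding oz using fin by (rule card_image_le)
  finally show ?thesis .
qed

end

section \<open>Defects as complex numbers\<close>

lemma spherical_design_sum:
  assumes "spherical_design t X" "polynomial_of_degree_le t f"
  shows "(\<Sum>x\<in>X. f x) = real (card X) * (\<integral>x. f x \<partial>sphere_measure)"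
proof (cases "card X = 0")
  case True
  then have "X = {}" using assms(1) by (auto simp: spherical_design_def)
  then show ?thesis by simp
next
  case False
  have "(\<Sum>x\<in>X. f x) / real (card X) = (\<integral>x. f x \<partial>sphere_measure)"
    using assms unfolding spherical_design_def by blast
  then show ?thesis using False by (simp add: field_simps)
qed

definition defect_complex :: "V \<Rightarrow> complex" where
  "defect_complex M = Complex (gram_diff M) (2 * gram_off M)"

text \<open>The factor makes this an isometry: without it \<open>E_inner\<close> would give twice
  the squared modulus.\<close>

definition traceless :: "complex \<Rightarrow> real^2^2" where
  "traceless z = (sqrt 2 / 2) *\<^sub>R vector [vector [Re z, Im z], vector [Im z, - Re z]]"

lemma traceless_add: "traceless (z + w) = traceless z + traceless w"
  by (simp add: traceless_def vec_eq_iff forall_2 algebra_simps)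

lemma traceless_in_E_space: "traceless z \<in> E_space"
  by (simp add: E_space_def traceless_def vec_eq_iff forall_2 transpose_def trace_def sum_2)

lemma E_inner_traceless: "E_inner (traceless z) (traceless w) = Re z * Re w + Im z * Im w"
proof -
  have "E_inner (traceless z) (traceless w)
    = (sqrt 2 / 2) * (sqrt 2 / 2) * (2 * (Re z * Re w + Im z * Im w))"
    by (simp add: E_inner_def traceless_def trace_def matrix_matrix_mult_def sum_2 algebra_simps
        del: times_divide_times_eq real_sqrt_mult_self)
  then show ?thesis by simp
qed

lemma traceless_in_E_circle: "norm z = 1 \<Longrightarrow> traceless z \<in> E_circle"
  by (simp add: E_circle_def traceless_in_E_space E_inner_traceless
      flip: power2_eq_square cmod_power2)

lemma normalized_defect_eq:
  assumes "M \<in> sphere 0 1"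
  shows "normalized_defect M = traceless (defect_complex M)"
proof -
  have "M \<bullet> M = 1" using assms by (simp add: dot_square_norm)
  then have snd: "snd M \<bullet> snd M = 1 - fst M \<bullet> fst M"
    by (simp add: inner_prod_def)
  show ?thesis
    by (simp add: snd normalized_defect_def defect_def gram_def traceless_def defect_complex_def
        gram_diff_def gram_off_def vec_eq_iff forall_2 mat_def inner_commute field_simps)
qed

text \<open>The squared difference of the eigenvalues of the Gram matrix is its squared trace minus
  four times its determinant, and the trace is 1.\<close>

lemma defect_complex_norm:
  assumes "M \<in> sphere 0 1"
  shows "(norm (defect_complex M))\<^sup>2
    = 1 - 4 * ((fst M \<bullet> fst M) * (snd M \<bullet> snd M) - (fst M \<bullet> snd M)\<^sup>2)"
proof -
  have "M \<bullet> M = 1" using assms by (simp add: dot_square_norm)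
  then have snd: "snd M \<bullet> snd M = 1 - fst M \<bullet> fst M"
    by (simp add: inner_prod_def)
  have norm: "(norm (defect_complex M))\<^sup>2
      = (fst M \<bullet> fst M - snd M \<bullet> snd M)\<^sup>2 + (2 * (fst M \<bullet> snd M))\<^sup>2"
    by (simp add: cmod_power2 defect_complex_def gram_diff_def gram_off_def)
  show ?thesis
    unfolding norm snd by (simp add: power2_eq_square algebra_simps)
qed

lemma norm_defect_complex_le:
  assumes "M \<in> sphere 0 1"
  shows "norm (defect_complex M) \<le> 1"
proof -
  have "(norm (defect_complex M))\<^sup>2 \<le> 1"
    using Cauchy_Schwarz_ineq[of "fst M" "snd M"] defect_complex_norm[OF assms] by simp
  then show ?thesis
    using power2_le_imp_le[of "norm (defect_complex M)" 1] by simp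
qed

lemma dependent_if_norm_defect_complex:
  assumes M: "M \<in> sphere 0 1" "norm (defect_complex M) = 1"
  shows "\<exists>w a b. w \<noteq> 0 \<and> (a \<noteq> 0 \<or> b \<noteq> 0) \<and> M = (a *\<^sub>R w, b *\<^sub>R w)"
proof (cases "fst M = 0")
  case True
  then have "snd M \<noteq> 0" using M(1) by (cases M) auto
  with True show ?thesis
    by (intro exI[of _ "snd M"] exI[of _ 0] exI[of _ 1]) (auto simp: prod_eq_iff)
next
  case False
  define t where "t = (fst M \<bullet> snd M) / (fst M \<bullet> fst M)"
  have ne: "fst M \<bullet> fst M \<noteq> 0" using False by simp
  have eq: "(fst M \<bullet> fst M) * (snd M \<bullet> snd M) = (fst M \<bullet> snd M)\<^sup>2"
    using defect_complex_norm[OF M(1)] M(2) by simp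
  have "(snd M - t *\<^sub>R fst M) \<bullet> (snd M - t *\<^sub>R fst M) =
      snd M \<bullet> snd M - 2 * t * (fst M \<bullet> snd M) + t * t * (fst M \<bullet> fst M)"
    by (simp add: inner_diff_left inner_diff_right inner_commute algebra_simps)
  also have "\<dots> = 0"
    using ne eq by (simp add: t_def field_simps power2_eq_square)
  finally have "snd M = t *\<^sub>R fst M" by simp
  with False show ?thesis
    by (intro exI[of _ "fst M"] exI[of _ 1] exI[of _ t]) (auto simp: prod_eq_iff)
qed

lemma rank_gram:
  assumes M: "M \<in> sphere 0 1" "norm (defect_complex M) = 1"
  shows "rank (gram M) = 1"
proof -
  have eq: "(fst M \<bullet> fst M) * (snd M \<bullet> snd M) = (fst M \<bullet> snd M)\<^sup>2"
    using defect_complex_norm[OF M(1)] M(2) by simp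
  then have "det (gram M) = 0"
    by (simp add: det_2 gram_def inner_commute power2_eq_square)
  then have "rank (gram M) < 2"
    by (simp add: det_eq_0_rank)
  moreover have "gram M \<noteq> 0"
  proof
    assume "gram M = 0"
    moreover have "gram M $ 1 $ 1 + gram M $ 2 $ 2 = M \<bullet> M"
      by (simp add: gram_def inner_prod_def)
    ultimately show False using M(1) by auto
  qed
  then have "rank (gram M) \<noteq> 0" by (simp add: rank_eq_0)
  ultimately show ?thesis by simp
qed

text \<open>The first three elementary symmetric functions of the four numbers vanish: the third one is
  the conjugate of the first up to the factor \<open>e\<^sub>4\<close>. So the four numbers are the roots of
  \<open>X^4 + e\<^sub>4\<close>.\<close>

lemma four_unit_complex_square:
  fixes \<zeta> :: "'i \<Rightarrow> complex"
  assumes card: "card I = 4" and norm: "\<And>i. i \<in> I \<Longrightarrow> norm (\<zeta> i) = 1"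
    and sum: "(\<Sum>i\<in>I. \<zeta> i) = 0" and sum_sq: "(\<Sum>i\<in>I. (\<zeta> i)\<^sup>2) = 0"
  shows "\<exists>p. norm p = 1 \<and> \<zeta> ` I = {p, \<i> * p, - p, - \<i> * p}"
proof -
  obtain i1 i2 i3 i4 where I: "I = {i1, i2, i3, i4}"
    "i1 \<noteq> i2" "i1 \<noteq> i3" "i1 \<noteq> i4" "i2 \<noteq> i3" "i2 \<noteq> i4" "i3 \<noteq> i4"
    using card by (auto simp: card_Suc_eq numeral_eq_Suc)
  define z1 z2 z3 z4 where z: "z1 = \<zeta> i1" "z2 = \<zeta> i2" "z3 = \<zeta> i3" "z4 = \<zeta> i4"
  have e1: "z1 + z2 + z3 + z4 = 0"
    using sum I by (simp add: z add_ac)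
  have p2: "z1\<^sup>2 + z2\<^sup>2 + z3\<^sup>2 + z4\<^sup>2 = 0"
    using sum_sq I by (simp add: z add_ac)
  have unit: "u * cnj u = 1" if "u \<in> {z1, z2, z3, z4}" for u
    using norm that I by (auto simp: z complex_norm_square[symmetric])
  have "2 * (z1*z2 + z1*z3 + z1*z4 + z2*z3 + z2*z4 + z3*z4)
      = (z1 + z2 + z3 + z4)\<^sup>2 - (z1\<^sup>2 + z2\<^sup>2 + z3\<^sup>2 + z4\<^sup>2)"
    by (simp add: power2_eq_square algebra_simps)
  also have "\<dots> = 0" by (simp only: e1 p2) simp
  finally have e2: "z1*z2 + z1*z3 + z1*z4 + z2*z3 + z2*z4 + z3*z4 = 0"
    by (simp only: mult_eq_0_iff) simp
  have "z2*z3*z4 + z1*z3*z4 + z1*z2*z4 + z1*z2*z3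
      = (z1 * cnj z1)*z2*z3*z4 + z1*(z2 * cnj z2)*z3*z4 + z1*z2*(z3 * cnj z3)*z4
        + z1*z2*z3*(z4 * cnj z4)"
    by (simp add: unit)
  also have "\<dots> = z1*z2*z3*z4 * cnj (z1 + z2 + z3 + z4)"
    by (simp add: algebra_simps)
  finally have e3: "z2*z3*z4 + z1*z3*z4 + z1*z2*z4 + z1*z2*z3 = 0"
    by (simp add: e1)
  have poly: "(X - z1) * (X - z2) * (X - z3) * (X - z4) = X^4 + z1*z2*z3*z4" for X
  proof -
    have "(X - z1) * (X - z2) * (X - z3) * (X - z4) = X^4 - (z1 + z2 + z3 + z4) * X^3
      + (z1*z2 + z1*z3 + z1*z4 + z2*z3 + z2*z4 + z3*z4) * X\<^sup>2
      - (z2*z3*z4 + z1*z3*z4 + z1*z2*z4 + z1*z2*z3) * X + z1*z2*z3*z4"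
      by algebra
    then show ?thesis by (simp only: e1 e2 e3) simp
  qed
  \<comment> \<open>\<open>z1\<close> is itself a root, so any \<open>X\<close> with the same fourth
    power is one too; this yields four distinct members, which exhaust the set.\<close>
  have root: "X \<in> {z1, z2, z3, z4}" if "X^4 = z1^4" for X
    using poly[of X] poly[of z1] that by auto
  have "\<zeta> ` I = {z1, z2, z3, z4}" by (simp add: I z)
  moreover have "{z1, \<i> * z1, - z1, - \<i> * z1} \<subseteq> {z1, z2, z3, z4}"
    using root[of "\<i> * z1"] root[of "- z1"] root[of "- \<i> * z1"]
    by (auto simp: power_mult_distrib)
  moreover have "card {z1, \<i> * z1, - z1, - \<i> * z1} = 4"
  proof -
    have nz: "z1 \<noteq> 0" using unit[of z1] by auto
    have "{z1, \<i> * z1, - z1, - \<i> * z1} = (\<lambda>c. c * z1) ` {1, \<i>, - 1, - \<i>}" by simp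
    also have "card \<dots> = card {1, \<i>, - 1, - \<i>}"
      using nz by (intro card_image) (simp add: inj_on_def)
    also have "\<dots> = 4"
      by (simp add: card_insert_if complex_eq_iff)
    finally show ?thesis .
  qed
  moreover have "card {z1, z2, z3, z4} \<le> 4"
    using card_length[of "[z1, z2, z3, z4]"] by simp
  ultimately have "\<zeta> ` I = {z1, \<i> * z1, - z1, - \<i> * z1}"
    using card_seteq[of "{z1, z2, z3, z4}" "{z1, \<i> * z1, - z1, - \<i> * z1}"] by simp
  moreover have "norm z1 = 1" using norm I by (simp add: z)
  ultimately show ?thesis by blast
qed

lemma is_square_traceless:
  assumes "norm p = 1"
  shows "is_square (traceless ` {p, \<i> * p, - p, - \<i> * p})"
proof -
  \<comment> \<open>The two sides at the vertex \<open>p\<close>; the opposite vertex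
    \<open>p + ?u + ?v\<close> is \<open>- p\<close>.\<close>
  let ?u = "\<i> * p - p" and ?v = "- \<i> * p - p"
  have "E_inner (traceless ?u) (traceless ?u) = 2 * ((Re p)\<^sup>2 + (Im p)\<^sup>2)"
    by (simp add: E_inner_traceless power2_eq_square algebra_simps)
  also have "\<dots> = 2" using assms by (simp flip: cmod_power2)
  finally have "E_inner (traceless ?u) (traceless ?u) = 2" .
  then have "traceless ?u \<noteq> 0"
    by (auto simp: E_inner_def trace_def matrix_matrix_mult_def sum_2)
  moreover have "E_inner (traceless ?u) (traceless ?u) = E_inner (traceless ?v) (traceless ?v)"
    "E_inner (traceless ?u) (traceless ?v) = 0"
    by (simp_all add: E_inner_traceless algebra_simps)
  moreover have "traceless ` {p, \<i> * p, - p, - \<i> * p} = {traceless p, traceless p + traceless ?u,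
      traceless p + traceless ?u + traceless ?v, traceless p + traceless ?v}"
    by (simp flip: traceless_add)
  ultimately show ?thesis
    unfolding is_square_def using traceless_in_E_space by blast
qed

lemma defect_complex_eq_0_iff:
  "defect_complex M = 0 \<longleftrightarrow> gram_diff M = 0 \<and> gram_off M = 0"
  by (auto simp: defect_complex_def complex_eq_iff)

text \<open>The mean of the square vanishes because 1/7 - 4/28 = 0 and the mixed moment is 0; that
  of the squared modulus is 1/7 + 4/28 = 2/7.\<close>

lemma design_defect_sums:
  assumes "spherical_design 4 Y"
  shows "(\<Sum>M\<in>Y. defect_complex M) = 0" "(\<Sum>M\<in>Y. (defect_complex M)\<^sup>2) = 0"
    "(\<Sum>M\<in>Y. (norm (defect_complex M))\<^sup>2) = 2 * real (card Y) / 7"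
proof -
  note sum = spherical_design_sum[OF assms]
  have "(\<Sum>M\<in>Y. gram_diff M) = 0" "(\<Sum>M\<in>Y. gram_off M) = 0"
    using sum[OF polynomial_gram(1)] sum[OF polynomial_gram(2)]
    by (simp_all add: integral_gram_diff integral_gram_off)
  then show "(\<Sum>M\<in>Y. defect_complex M) = 0"
    by (simp add: complex_eq_iff defect_complex_def flip: sum_distrib_left)
  have sq: "(\<Sum>M\<in>Y. (gram_diff M)\<^sup>2) = real (card Y) / 7"
    "(\<Sum>M\<in>Y. (gram_off M)\<^sup>2) = real (card Y) / 28"
    "(\<Sum>M\<in>Y. gram_diff M * gram_off M) = 0"
    using polynomial_gram_products[THEN sum]
    by (simp_all add: integral_gram_squares integral_gram_diff_off)
  have "(defect_complex M)\<^sup>2 = Complex ((gram_diff M)\<^sup>2 - 4 * (gram_off M)\<^sup>2)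
      (4 * (gram_diff M * gram_off M))" for M
    by (simp add: complex_eq_iff defect_complex_def power2_eq_square)
  then show "(\<Sum>M\<in>Y. (defect_complex M)\<^sup>2) = 0"
    by (simp add: complex_eq_iff sum_subtractf sq flip: sum_distrib_left)
  have "(norm (defect_complex M))\<^sup>2 = (gram_diff M)\<^sup>2 + 4 * (gram_off M)\<^sup>2" for M
    by (simp add: cmod_power2 defect_complex_def power_mult_distrib)
  then show "(\<Sum>M\<in>Y. (norm (defect_complex M))\<^sup>2) = 2 * real (card Y) / 7"
    by (simp add: sum.distrib sq flip: sum_distrib_left)
qed

section \<open>Orbits and their defects\<close>

context e6_system
begin

lemma defect_complex_orbit:
  assumes "N \<in> weyl_orbit \<alpha> M"
  shows "defect_complex N = defect_complex M"
proof -
  obtain g where "g \<in> G" "N = act g M"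
    using assms unfolding weyl_orbit_def by blast
  then show ?thesis
    by (simp add: defect_complex_def gram_diff_def gram_off_def act_def G_inner)
qed

lemma weyl_orbit_subset:
  "weyl_invariant \<alpha> Y \<Longrightarrow> M \<in> Y \<Longrightarrow> weyl_orbit \<alpha> M \<subseteq> Y"
  unfolding weyl_invariant_def weyl_orbit_def by blast

text \<open>The defect is constant on an orbit and has mean 0 on the sphere, and a 2-design
  reproduces the means of quadratic forms.\<close>

lemma design_orbit_defect_zero:
  assumes "spherical_design 2 (weyl_orbit \<alpha> M)"
  shows "defect_complex M = 0"
proof -
  let ?O = "weyl_orbit \<alpha> M"
  have fin: "finite ?O" using assms by (simp add: spherical_design_def)
  then have card: "card ?O \<noteq> 0" using self_in_weyl_orbit[of M] by auto
  have const: "gram_diff N = gram_diff M" "gram_off N = gram_off M" if "N \<in> ?O" for N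
    using defect_complex_orbit[OF that] by (auto simp: defect_complex_def)
  have "(\<Sum>N\<in>?O. gram_diff N) = 0" "(\<Sum>N\<in>?O. gram_off N) = 0"
    using spherical_design_sum[OF assms polynomial_gram(1)]
      spherical_design_sum[OF assms polynomial_gram(2)]
    by (simp_all add: integral_gram_diff integral_gram_off)
  then show ?thesis
    using card by (simp add: const defect_complex_eq_0_iff)
qed

lemma card_orbit_defect_zero:
  assumes "finite (weyl_orbit \<alpha> M)" "M \<in> sphere 0 1" "defect_complex M = 0"
  shows "270 \<le> card (weyl_orbit \<alpha> M)"
proof -
  have eq: "fst M \<bullet> fst M = snd M \<bullet> snd M" and orth: "fst M \<bullet> snd M = 0"
    using assms(3) by (auto simp: defect_complex_eq_0_iff gram_diff_def gram_off_def)
  have "M \<bullet> M = 1" using assms(2) by (simp add: dot_square_norm)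
  then have half: "fst M \<bullet> fst M = 1 / 2"
    using eq by (simp add: inner_prod_def)
  have "snd M \<noteq> t *\<^sub>R fst M" for t
  proof
    assume t: "snd M = t *\<^sub>R fst M"
    then have "t * (1 / 2) = 0" using orth half by simp
    then show False using t half eq by simp
  qed
  moreover have "fst M \<noteq> 0" using half by auto
  ultimately show ?thesis
    using card_weyl_orbit_independent[of "fst M" "snd M"] assms(1) by simp
qed

text \<open>The columns are proportional, so the orbit is in bijection with that of a single vector
  of \<open>W\<close>.\<close>

lemma card_orbit_rank_one:
  assumes fin: "finite (weyl_orbit \<alpha> M)" and M: "M \<in> sphere 0 1" "norm (defect_complex M) = 1"
    and small: "card (weyl_orbit \<alpha> M) \<le> 54"
  shows "card (weyl_orbit \<alpha> M) = 27"
proof -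
  obtain w a b where w: "w \<noteq> 0" "a \<noteq> 0 \<or> b \<noteq> 0" "M = (a *\<^sub>R w, b *\<^sub>R w)"
    using dependent_if_norm_defect_complex[OF M] by blast
  have orb: "weyl_orbit \<alpha> M = (\<lambda>v. (a *\<^sub>R v, b *\<^sub>R v)) ` orbit w"
    unfolding weyl_orbit_def orbit_def image_image w(3)
    by (intro image_cong) (auto simp: act_def linear_scale[OF G_linear])
  have "inj_on (\<lambda>v. (a *\<^sub>R v, b *\<^sub>R v)) (orbit w)"
    using w(2) by (auto simp: inj_on_def)
  then have "card (weyl_orbit \<alpha> M) = card (orbit w)" "finite (orbit w)"
    using fin unfolding orb by (simp_all add: card_image finite_image_iff)
  then show ?thesis
    using card_orbit_small[of w] w(1) small by simp
qed

end

theorem theorem8p2: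
  fixes \<alpha> :: "nat \<Rightarrow> W" and Y :: "V set"
  assumes "E6_simple_roots \<alpha>"
    and "weyl_invariant \<alpha> Y"
    and "spherical_design 4 Y"
    and "\<exists>M\<in>Y. spherical_design 2 (weyl_orbit \<alpha> M)"
  shows "card Y \<ge> 378 \<and>
    (card Y = 378 \<longrightarrow>
      (\<exists>P \<C>.
        weyl_orbit \<alpha> ` Y = insert P \<C> \<and>
        card P = 270 \<and> spherical_design 2 P \<and>
        card \<C> = 4 \<and>
        (\<forall>C\<in>\<C>. card C = 27 \<and> rank_one_correction_orbit \<alpha> C) \<and>
        normalized_defect ` (\<Union>\<C>) \<subseteq> E_circle \<and>
        is_square (normalized_defect ` (\<Union>\<C>))))"
proof -
  interpret e6_system \<alpha> by unfold_locales (fact assms(1))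
  have fin: "finite Y" and sphere: "Y \<subseteq> sphere 0 1"
    using assms(3) by (auto simp: spherical_design_def)
  note sums = design_defect_sums[OF assms(3)]
  have orb_fin: "finite (weyl_orbit \<alpha> M)" if "M \<in> Y" for M
    using weyl_orbit_subset[OF assms(2) that] fin by (rule finite_subset)
  define Y0 where "Y0 = {M \<in> Y. defect_complex M = 0}"
  define Y1 where "Y1 = {M \<in> Y. defect_complex M \<noteq> 0}"
  have Y: "Y = Y0 \<union> Y1" "Y0 \<inter> Y1 = {}" and fin01: "finite Y0" "finite Y1"
    using fin by (auto simp: Y0_def Y1_def)
  have card_Y: "card Y = card Y0 + card Y1"
    using Y fin01 by (simp add: card_Un_disjoint)
  obtain M0 where M0: "M0 \<in> Y" and design: "spherical_design 2 (weyl_orbit \<alpha> M0)"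
    using assms(4) by blast
  let ?P = "weyl_orbit \<alpha> M0"
  have M0_zero: "defect_complex M0 = 0"
    using design by (rule design_orbit_defect_zero)
  have P_sub: "?P \<subseteq> Y0"
  proof
    fix N assume N: "N \<in> ?P"
    then show "N \<in> Y0"
      using weyl_orbit_subset[OF assms(2) M0] defect_complex_orbit[OF N] M0_zero
      by (auto simp: Y0_def)
  qed
  have P_ge: "270 \<le> card ?P"
    using card_orbit_defect_zero[OF orb_fin[OF M0] _ M0_zero] sphere M0 by blast
  have P_le: "card ?P \<le> card Y0"
    using P_sub fin01 by (intro card_mono)
  have norm_le: "(norm (defect_complex M))\<^sup>2 \<le> 1" if "M \<in> Y1" for M
    using norm_defect_complex_le[of M] that sphere by (auto simp: Y1_def power_le_one)
  have sum_Y1: "(\<Sum>M\<in>Y1. f M) = (\<Sum>M\<in>Y. f M)" if "\<And>M. M \<in> Y0 \<Longrightarrow> f M = 0"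
    for f :: "V \<Rightarrow> 'c::comm_monoid_add"
    using that fin by (intro sum.mono_neutral_left) (auto simp: Y0_def Y1_def)
  have energy: "(\<Sum>M\<in>Y1. (norm (defect_complex M))\<^sup>2) = 2 * real (card Y) / 7"
    by (subst sum_Y1) (auto simp: Y0_def sums(3))
  have "(\<Sum>M\<in>Y1. (norm (defect_complex M))\<^sup>2) \<le> (\<Sum>M\<in>Y1. 1)"
    using norm_le by (rule sum_mono)
  with energy have "2 * card Y \<le> 7 * card Y1" by simp
  then have ge: "378 \<le> card Y" using P_ge P_le card_Y by linarith
  show ?thesis
  proof (intro conjI impI ge)
    assume N: "card Y = 378"
    \<comment> \<open>Seven times \<open>card Y1\<close> is at least 756, so \<open>Y1\<close> has
      at least 108 points; with the 270 of \<open>?P\<close> this is already 378, and every estimate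
      is tight.\<close>
    then have card01: "card Y0 = 270" "card Y1 = 108" "card ?P = 270"
      using \<open>2 * card Y \<le> 7 * card Y1\<close> P_ge P_le card_Y by linarith+
    have P: "?P = Y0"
      using card_seteq[OF fin01(1) P_sub] card01 by simp
    have norm_1: "norm (defect_complex M) = 1" if "M \<in> Y1" for M
    proof -
      \<comment> \<open>The value is 108 - 2 * 378 / 7 = 0, a sum of nonnegative terms.\<close>
      have "(\<Sum>M\<in>Y1. 1 - (norm (defect_complex M))\<^sup>2) = 0"
        using energy N card01 by (simp add: sum_subtractf)
      then have "1 - (norm (defect_complex M))\<^sup>2 = 0"
        using norm_le that fin01(2) by (subst (asm) sum_nonneg_eq_0_iff) auto
      then show ?thesis
        using norm_ge_zero[of "defect_complex M"] by (auto simp: power2_eq_1_iff)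
    qed
    define \<C> where "\<C> = weyl_orbit \<alpha> ` Y1"
    have orb_sub: "weyl_orbit \<alpha> M \<subseteq> Y1" if "M \<in> Y1" for M
    proof
      fix N assume N: "N \<in> weyl_orbit \<alpha> M"
      then show "N \<in> Y1"
        using weyl_orbit_subset[OF assms(2), of M] defect_complex_orbit[OF N] that
        by (auto simp: Y1_def)
    qed
    have orbit_of: "C = weyl_orbit \<alpha> N" if "C \<in> \<C>" "N \<in> C" for C N
    proof -
      obtain M where "C = weyl_orbit \<alpha> M" using \<open>C \<in> \<C>\<close> unfolding \<C>_def by blast
      then show ?thesis using weyl_orbit_eq[of N M] \<open>N \<in> C\<close> by simp
    qed
    have Union: "\<Union>\<C> = Y1"
      using orb_sub self_in_weyl_orbit unfolding \<C>_def by blast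
    have disj: "C \<inter> D = {}" if CD: "C \<in> \<C>" "D \<in> \<C>" "C \<noteq> D" for C D
    proof (rule ccontr)
      assume "C \<inter> D \<noteq> {}"
      then obtain N where "N \<in> C" "N \<in> D" by blast
      then show False using CD orbit_of[of C N] orbit_of[of D N] by simp
    qed
    have card_27: "card (weyl_orbit \<alpha> M) = 27" if M: "M \<in> Y1" for M
    proof (rule card_orbit_rank_one)
      let ?C = "weyl_orbit \<alpha> M"
      have finC: "finite ?C" using orb_sub[OF M] fin01(2) by (rule finite_subset)
      show "finite ?C" by (fact finC)
      show "M \<in> sphere 0 1" using M sphere by (auto simp: Y1_def)
      show "norm (defect_complex M) = 1" using M by (rule norm_1)
      have "(\<Sum>N\<in>Y1. defect_complex N) = 0"
        by (subst sum_Y1) (auto simp: Y0_def sums(1))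
      \<comment> \<open>The orbit contributes \<open>card ?C\<close> equal unit numbers, which the
        remaining points of \<open>Y1\<close> must cancel; hence these are at least as
        numerous.\<close>
      then have "(\<Sum>N\<in>?C. defect_complex N) = - (\<Sum>N\<in>Y1 - ?C. defect_complex N)"
        using sum.subset_diff[OF orb_sub[OF M] fin01(2), of defect_complex]
        by (simp add: eq_neg_iff_add_eq_0 add.commute)
      moreover have "(\<Sum>N\<in>?C. defect_complex N) = of_nat (card ?C) * defect_complex M"
        by (simp add: defect_complex_orbit)
      ultimately have "real (card ?C) = norm (\<Sum>N\<in>Y1 - ?C. defect_complex N)"
        using norm_1[OF M] by (metis mult.right_neutral norm_minus_cancel norm_mult norm_of_nat)
      also have "\<dots> \<le> (\<Sum>N\<in>Y1 - ?C. 1)"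
        using norm_1 by (intro sum_norm_le) auto
      also have "\<dots> = real (card Y1 - card ?C)"
        using orb_sub[OF M] finC by (simp add: card_Diff_subset)
      finally show "card ?C \<le> 54" using card01(2) by linarith
    qed
    have fin\<C>: "finite \<C>" using fin01(2) by (simp add: \<C>_def)
    have "27 * card \<C> = card (\<Union>\<C>)"
      using fin\<C> Union fin01(2) disj card_27 by (intro card_partition) (auto simp: \<C>_def)
    then have card\<C>: "card \<C> = 4" using Union card01(2) by simp
    \<comment> \<open>The choice of a member is immaterial, as \<open>defect_complex\<close> is
      constant on each orbit.\<close>
    define \<zeta> where "\<zeta> C = defect_complex (SOME M. M \<in> C)" for C
    have \<zeta>: "\<zeta> C = defect_complex M" if "C \<in> \<C>" "M \<in> C" for C M
    proof -
      have "(SOME M. M \<in> C) \<in> C" using that(2) by (rule someI)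
      then show ?thesis
        unfolding \<zeta>_def using defect_complex_orbit orbit_of[OF that] by blast
    qed
    have nonempty: "\<exists>M. M \<in> C \<and> M \<in> Y1" if "C \<in> \<C>" for C
      using that self_in_weyl_orbit unfolding \<C>_def by blast
    have sum_\<zeta>: "(\<Sum>M\<in>Y1. h (defect_complex M)) = 27 * (\<Sum>C\<in>\<C>. h (\<zeta> C))"
      for h :: "complex \<Rightarrow> complex"
    proof -
      have "(\<Sum>M\<in>Y1. h (defect_complex M)) = (\<Sum>C\<in>\<C>. \<Sum>M\<in>C. h (defect_complex M))"
        unfolding Union[symmetric] using fin01(2) orb_sub disj
        by (subst sum.Union_disjoint) (auto simp: \<C>_def intro: finite_subset)
      also have "\<dots> = (\<Sum>C\<in>\<C>. of_nat (card C) * h (\<zeta> C))"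
        by (intro sum.cong) (simp_all add: \<zeta>[symmetric])
      also have "\<dots> = (\<Sum>C\<in>\<C>. 27 * h (\<zeta> C))"
        using card_27 by (intro sum.cong) (auto simp: \<C>_def)
      finally show ?thesis by (simp add: sum_distrib_left)
    qed
    have "(\<Sum>M\<in>Y1. defect_complex M) = 0" "(\<Sum>M\<in>Y1. (defect_complex M)\<^sup>2) = 0"
      by (subst sum_Y1, auto simp: Y0_def sums)+
    then have \<zeta>_sums: "(\<Sum>C\<in>\<C>. \<zeta> C) = 0" "(\<Sum>C\<in>\<C>. (\<zeta> C)\<^sup>2) = 0"
      using sum_\<zeta>[of "\<lambda>z. z"] sum_\<zeta>[of "\<lambda>z. z\<^sup>2"] by simp_all
    have "norm (\<zeta> C) = 1" if "C \<in> \<C>" for C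
    proof -
      obtain M where "M \<in> C" "M \<in> Y1" using nonempty[OF \<open>C \<in> \<C>\<close>] by blast
      then show ?thesis using \<zeta>[OF \<open>C \<in> \<C>\<close>] norm_1 by metis
    qed
    from four_unit_complex_square[OF card\<C> this \<zeta>_sums]
    obtain p where p: "norm p = 1" "\<zeta> ` \<C> = {p, \<i> * p, - p, - \<i> * p}" by blast
    have "defect_complex ` Y1 = \<zeta> ` \<C>"
    proof (intro set_eqI iffI)
      fix z assume "z \<in> defect_complex ` Y1"
      then obtain M where M: "M \<in> Y1" "z = defect_complex M" by blast
      have C: "weyl_orbit \<alpha> M \<in> \<C>" using M(1) by (simp add: \<C>_def)
      then have "z = \<zeta> (weyl_orbit \<alpha> M)"
        using \<zeta>[OF C self_in_weyl_orbit] M(2) by simp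
      with C show "z \<in> \<zeta> ` \<C>" by blast
    next
      fix z assume "z \<in> \<zeta> ` \<C>"
      then obtain C where C: "C \<in> \<C>" "z = \<zeta> C" by blast
      obtain M where "M \<in> C" "M \<in> Y1" using nonempty[OF C(1)] by blast
      then show "z \<in> defect_complex ` Y1" using \<zeta>[OF C(1)] C(2) by blast
    qed
    moreover have nd: "normalized_defect M = traceless (defect_complex M)" if "M \<in> Y1" for M
      using that sphere by (intro normalized_defect_eq) (auto simp: Y1_def)
    then have "normalized_defect ` Y1 = traceless ` defect_complex ` Y1"
      unfolding image_image by (intro image_cong) auto
    ultimately have image: "normalized_defect ` Y1 = traceless ` {p, \<i> * p, - p, - \<i> * p}"
      using p by simp
    have circle: "normalized_defect M \<in> E_circle" if "M \<in> Y1" for M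
      using nd[OF that] norm_1[OF that] by (simp add: traceless_in_E_circle)
    have rank_one: "rank_one_correction_orbit \<alpha> (weyl_orbit \<alpha> M)" if M: "M \<in> Y1" for M
    proof -
      have "M \<in> sphere 0 1" using M sphere by (auto simp: Y1_def)
      moreover have "defect M \<noteq> 0"
        using circle[OF M]
        by (auto simp: E_circle_def E_inner_def normalized_defect_def trace_def
            matrix_matrix_mult_def)
      ultimately show ?thesis
        unfolding rank_one_correction_orbit_def using rank_gram norm_1[OF M] by blast
    qed
    have "weyl_orbit \<alpha> ` Y0 = {?P}"
    proof (intro set_eqI iffI)
      fix C assume "C \<in> weyl_orbit \<alpha> ` Y0"
      then obtain M where "M \<in> ?P" "C = weyl_orbit \<alpha> M" using P by blast
      then show "C \<in> {?P}" using weyl_orbit_eq[of M M0] by simp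
    next
      fix C assume "C \<in> {?P}"
      then show "C \<in> weyl_orbit \<alpha> ` Y0" using P self_in_weyl_orbit[of M0] by auto
    qed
    then have "weyl_orbit \<alpha> ` Y = insert ?P \<C>"
      unfolding Y(1) image_Un \<C>_def by simp
    then show "\<exists>P \<C>.
        weyl_orbit \<alpha> ` Y = insert P \<C> \<and>
        card P = 270 \<and> spherical_design 2 P \<and>
        card \<C> = 4 \<and>
        (\<forall>C\<in>\<C>. card C = 27 \<and> rank_one_correction_orbit \<alpha> C) \<and>
        normalized_defect ` (\<Union>\<C>) \<subseteq> E_circle \<and>
        is_square (normalized_defect ` (\<Union>\<C>))"
    proof (intro exI[of _ ?P] exI[of _ \<C>] conjI ballI)
      show "card C = 27" "rank_one_correction_orbit \<alpha> C" if "C \<in> \<C>" for C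
        using that card_27 rank_one unfolding \<C>_def by blast+
      show "normalized_defect ` (\<Union>\<C>) \<subseteq> E_circle"
        unfolding Union using circle by blast
      show "is_square (normalized_defect ` (\<Union>\<C>))"
        unfolding Union image by (rule is_square_traceless) (fact p(1))
    qed (simp_all add: card01(3) design card\<C>)
  qed
qed

end
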